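(* Let $X$ be a standard Borel space, $E$ a countable Borel equivalence relation on $X$, and let $F$ be a Borel enumerable equivalence relation on the quotient Borel space $(X,E)$. Then there is a countable group $\Gamma$ acting in a Borel fashion on $(X,E)$ whose orbit equivalence relation $E_\Gamma^{(X,E)}$ equals $F$.
   Context: "Countable" means finite or countably infinite; an equivalence relation is countable if all its classes are countable. A quotient Borel space is a pair $(X,E)$ with $X$ a standard Borel space and $E$ a countable Borel equivalence relation on $X$ (Borel as a subset of $X\times X$); its underlying set is $X/E$. With $\pi_E:X\to X/E$ the quotient map, a subset $A\subseteq X/E$ is Borel in $(X,E)$ iff $\pi_E^{-1}[A]$ is Borel in $X$. The product $(X,E)\times(Y,F)$ is the quotient Borel space $(X\times Y,E\times F)$, where $(x_1,y_1)\,(E\times F)\,(x_2,y_2)$ iff $x_1Ex_2$ and $y_1Fy_2$; its underlying set is identified with $X/E\times Y/F$. A binary relation $R\subseteq (X,E)\times(Y,F)$ is Borel if it is a Borel subset of this product quotient Borel space (i.e. its preimage in $X\times Y$ is Borel). A function $f:(X,E)\to(Y,F)$, i.e. a function $X/E\to Y/F$, is Borel if its graph is a Borel relation. A Borel endomorphism of $(X,E)$ is a Borel function $(X,E)\to(X,E)$; a Borel automorphism is a bijective one. An equivalence relation $F$ on (the underlying set of) a quotient Borel space $(X,E)$ is Borel enumerable if there is a countable family $\{f_n : n\in\mathbb{N}\}$ of Borel endomorphisms of $(X,E)$ such that $F=\bigcup_n f_n$ (functions being identified with their graphs). An action of a countable group $\Gamma$ on $(X,E)$ (i.e. on the set $X/E$)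 is Borel if, for each $\gamma\in\Gamma$, the permutation $x\mapsto\gamma\cdot x$ of $X/E$ is a Borel automorphism of $(X,E)$. Its orbit equivalence relation is given by $x\,E_\Gamma^{(X,E)}\,y$ iff there is $\gamma\in\Gamma$ with $y=\gamma\cdot x$. *)

theory Defs
  imports "HOL-Analysis.Analysis" "HOL-Algebra.Group_Action"
begin

text \<open>Measurable spaces are represented by the type \<open>measure\<close>; only the components
  \<open>space\<close> and \<open>sets\<close> are ever used, never the measure itself.\<close>

definition polish_topology :: "'a topology \<Rightarrow> bool" where
  "polish_topology T \<longleftrightarrow> completely_metrizable_space T \<and> separable_space T"

definition standard_borel_space :: "'a measure \<Rightarrow> bool" where
  "standard_borel_space X \<longleftrightarrow>
     (\<exists>T. polish_topology T \<and> space X = topspace T \<and>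
          sets X = sigma_sets (topspace T) {U. openin T U})"

definition countable_borel_equiv :: "'a measure \<Rightarrow> ('a \<times> 'a) set \<Rightarrow> bool" where
  "countable_borel_equiv X E \<longleftrightarrow>
     equiv (space X) E \<and> E \<in> sets (X \<Otimes>\<^sub>M X) \<and> (\<forall>C \<in> space X // E. countable C)"

text \<open>A quotient Borel space \<open>(X, E)\<close> is given by two separate arguments, with
  \<open>standard_borel_space X\<close> and \<open>countable_borel_equiv X E\<close>; its underlying set is \<open>space X // E\<close>.\<close>

definition quotient_borel_set :: "'a measure \<Rightarrow> ('a \<times> 'a) set \<Rightarrow> 'a set set \<Rightarrow> bool" where
  "quotient_borel_set X E A \<longleftrightarrow> A \<subseteq> space X // E \<and> {x \<in> space X. E `` {x} \<in> A} \<in> sets X"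

definition prod_equiv :: "('a \<times> 'a) set \<Rightarrow> ('b \<times> 'b) set \<Rightarrow> (('a \<times> 'b) \<times> ('a \<times> 'b)) set" where
  "prod_equiv E F = {((x1, y1), (x2, y2)) | x1 y1 x2 y2. (x1, x2) \<in> E \<and> (y1, y2) \<in> F}"

text \<open>The class of \<open>(x, y)\<close> under \<open>prod_equiv E F\<close> is the Cartesian product of the class of
  \<open>x\<close> and the class of \<open>y\<close>. So \<open>(C, D) \<mapsto> C \<times> D\<close> is the identification of the product of
  the underlying sets with the underlying set of the product quotient Borel space.\<close>

lemma prod_equiv_class: "prod_equiv E F `` {(x, y)} = (E `` {x}) \<times> (F `` {y})"
  by (auto simp: prod_equiv_def)

definition borel_relation ::
  "'a measure \<Rightarrow> ('a \<times> 'a) set \<Rightarrow> 'b measure \<Rightarrow> ('b \<times> 'b) set \<Rightarrow> ('a set \<times> 'b set) set \<Rightarrow> bool"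
  where
  "borel_relation X E Y F R \<longleftrightarrow>
     R \<subseteq> (space X // E) \<times> (space Y // F) \<and>
     quotient_borel_set (X \<Otimes>\<^sub>M Y) (prod_equiv E F) ((\<lambda>(C, D). C \<times> D) ` R)"

definition graph_on :: "'a set \<Rightarrow> ('a \<Rightarrow> 'b) \<Rightarrow> ('a \<times> 'b) set" where
  "graph_on S f = {(x, f x) | x. x \<in> S}"

definition borel_function ::
  "'a measure \<Rightarrow> ('a \<times> 'a) set \<Rightarrow> 'b measure \<Rightarrow> ('b \<times> 'b) set \<Rightarrow> ('a set \<Rightarrow> 'b set) \<Rightarrow> bool"
  where
  "borel_function X E Y F f \<longleftrightarrow>
     f \<in> (space X // E) \<rightarrow> (space Y // F) \<and>
     borel_relation X E Y F (graph_on (space X // E) f)"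

definition borel_endomorphism ::
  "'a measure \<Rightarrow> ('a \<times> 'a) set \<Rightarrow> ('a set \<Rightarrow> 'a set) \<Rightarrow> bool" where
  "borel_endomorphism X E f \<longleftrightarrow> borel_function X E X E f"

definition borel_automorphism ::
  "'a measure \<Rightarrow> ('a \<times> 'a) set \<Rightarrow> ('a set \<Rightarrow> 'a set) \<Rightarrow> bool" where
  "borel_automorphism X E f \<longleftrightarrow>
     borel_endomorphism X E f \<and> bij_betw f (space X // E) (space X // E)"

definition borel_enumerable ::
  "'a measure \<Rightarrow> ('a \<times> 'a) set \<Rightarrow> ('a set \<times> 'a set) set \<Rightarrow> bool" where
  "borel_enumerable X E F \<longleftrightarrow>
     (\<exists>f :: nat \<Rightarrow> 'a set \<Rightarrow> 'a set.
        (\<forall>n. borel_endomorphism X E (f n)) \<and> F = (\<Union>n. graph_on (space X // E) (f n)))"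

definition borel_action ::
  "('g, 'm) monoid_scheme \<Rightarrow> 'a measure \<Rightarrow> ('a \<times> 'a) set \<Rightarrow> ('g \<Rightarrow> 'a set \<Rightarrow> 'a set) \<Rightarrow> bool"
  where
  "borel_action G X E \<phi> \<longleftrightarrow>
     group_action G (space X // E) \<phi> \<and> (\<forall>g \<in> carrier G. borel_automorphism X E (\<phi> g))"

definition orbit_equiv ::
  "('g, 'm) monoid_scheme \<Rightarrow> 's set \<Rightarrow> ('g \<Rightarrow> 's \<Rightarrow> 's) \<Rightarrow> ('s \<times> 's) set" where
  "orbit_equiv G S \<phi> = {(x, y). x \<in> S \<and> (\<exists>g \<in> carrier G. y = \<phi> g x)}"

end

theory Submission
  imports Defs "HOL-Algebra.Generated_Groups" "HOL-Algebra.Weak_Morphisms"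
begin

text \<open>The relation \<open>F\<close> is the union of the partial bijections \<open>f\<^sub>n \<inter> f\<^sub>m\<inverse>\<close>. On a quotient there need not be a countable
  family of Borel sets separating points, so the usual Feldman--Moore argument for making domains and ranges
  disjoint is not available. Instead each partial bijection \<open>g\<close> is cut along its orbits: points at a
  fixed distance from the beginning or from the end of their orbit have a \<open>g\<close>-image at a different distance, so there
  \<open>g\<close> extends to an involution; the rest of the space is permuted by \<open>g\<close>. The countably many automorphisms obtained in
  this way generate \<open>\<Gamma>\<close>. All sets involved are Borel because, for Borel functions on \<open>X/E\<close>, they and their
  complements are both projections of Borel sets, whence Lusin's separation theorem applies.\<close>

section \<open>Analytic sets\<close>

text \<open>A Borel function on \<open>X/E\<close> is handled through its graph alone; no Borel map
  on \<open>X\<close> inducing it is ever chosen. Already composites and preimages of such functions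
  then hide a quantifier over representatives in \<open>X\<close>, so even the closure of the Borel
  automorphisms under products is a question about projections. Separation needs only two properties
  of a space: Borel sets are analytic, and distinct points have disjoint open Borel neighbourhoods.
  These pass easily to products, and products are needed because a composite is a projection from
  triples of points to pairs.

  Both ends of an orbit have to be considered: an orbit that is infinite in one direction only has a
  beginning or an end, but not both, so neither distance alone reaches all such orbits. The orbits
  with no end at all are the two-sided infinite ones and the finite cycles. Every automorphism
  produced from \<open>g\<close> stays inside \<open>g\<close>, its converse and the identity, hence
  inside \<open>F\<close>; this bounds the orbits of \<open>\<Gamma>\<close> from above, and the
  covering of \<open>F\<close> bounds them from below.\<close>

definition baire_cyl :: "nat \<Rightarrow> (nat \<Rightarrow> nat) \<Rightarrow> (nat \<Rightarrow> nat) set" where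
  "baire_cyl n \<alpha> = {\<beta>. \<forall>i<n. \<beta> i = \<alpha> i}"

lemma baire_cyl_self [simp]: "\<alpha> \<in> baire_cyl n \<alpha>"
  by (simp add: baire_cyl_def)

lemma baire_cyl_cong: "(\<And>i. i < n \<Longrightarrow> \<alpha> i = \<beta> i) \<Longrightarrow> baire_cyl n \<alpha> = baire_cyl n \<beta>"
  by (auto simp: baire_cyl_def)

lemma open_coordinate: "open {\<alpha> :: nat \<Rightarrow> nat. \<alpha> i = k}"
proof -
  have "open ((\<lambda>\<alpha> :: nat \<Rightarrow> nat. \<alpha> i) -` {k})"
    by (rule open_vimage) (auto simp: open_discrete)
  then show ?thesis by (simp add: vimage_def)
qed

lemma open_baire_cyl: "open (baire_cyl n \<alpha>)"
proof -
  have "baire_cyl n \<alpha> = (\<Inter>i\<in>{..<n}. {\<beta>. \<beta> i = \<alpha> i})"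
    by (auto simp: baire_cyl_def)
  then show ?thesis
    by (simp add: open_coordinate open_INT)
qed

lemma open_contains_baire_cyl:
  assumes "open U" "\<alpha> \<in> U"
  obtains n where "baire_cyl n \<alpha> \<subseteq> U"
proof -
  have "openin (product_topology (\<lambda>i :: nat. euclidean :: nat topology) UNIV) U"
    using assms unfolding open_fun_def by auto
  from product_topology_open_contains_basis[OF this \<open>\<alpha> \<in> U\<close>]
  obtain X :: "nat \<Rightarrow> nat set"
    where X: "\<alpha> \<in> (\<Pi>\<^sub>E i\<in>UNIV. X i)" "finite {i. X i \<noteq> UNIV}" "(\<Pi>\<^sub>E i\<in>UNIV. X i) \<subseteq> U"
    by auto
  obtain n where "{i. X i \<noteq> UNIV} \<subseteq> {..<n}"
    using X(2) finite_nat_iff_bounded by blast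
  then have n: "X i = UNIV" if "\<not> i < n" for i
    using that by blast
  have "baire_cyl n \<alpha> \<subseteq> U"
  proof
    fix \<beta> assume \<beta>: "\<beta> \<in> baire_cyl n \<alpha>"
    have "\<beta> i \<in> X i" for i
    proof (cases "i < n")
      case True
      then have "\<beta> i = \<alpha> i" using \<beta> by (simp add: baire_cyl_def)
      then show ?thesis using X(1) by auto
    qed (simp add: n)
    then show "\<beta> \<in> U" using X(3) by auto
  qed
  then show thesis ..
qed

lemma open_baire_iff: "open U \<longleftrightarrow> (\<forall>\<alpha>\<in>U. \<exists>n. baire_cyl n \<alpha> \<subseteq> U)"
  using open_contains_baire_cyl open_baire_cyl baire_cyl_self
  by (metis open_subopen)

lemma closed_baireI:
  assumes "\<And>\<alpha>. (\<And>n. \<exists>\<beta>\<in>C. \<beta> \<in> baire_cyl n \<alpha>) \<Longrightarrow> \<alpha> \<in> C"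
  shows "closed C"
  unfolding closed_def open_baire_iff
proof
  fix \<alpha> assume "\<alpha> \<in> - C"
  then obtain n where "\<forall>\<beta>\<in>C. \<beta> \<notin> baire_cyl n \<alpha>"
    using assms[of \<alpha>] by blast
  then show "\<exists>n. baire_cyl n \<alpha> \<subseteq> - C" by blast
qed

lemma closed_baireD:
  assumes "closed C" "\<And>n. \<exists>\<beta>\<in>C. \<beta> \<in> baire_cyl n \<alpha>"
  shows "\<alpha> \<in> C"
proof (rule ccontr)
  assume "\<alpha> \<notin> C"
  then obtain n where "baire_cyl n \<alpha> \<subseteq> - C"
    using open_contains_baire_cyl[of "- C" \<alpha>] assms(1) by (auto simp: closed_def)
  with assms(2)[of n] show False by blast
qed

lemma continuous_map_baireI:
  assumes "f \<in> C \<rightarrow> topspace T"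
    and "\<And>U \<alpha>. openin T U \<Longrightarrow> \<alpha> \<in> C \<Longrightarrow> f \<alpha> \<in> U \<Longrightarrow> \<exists>n. \<forall>\<beta>\<in>C \<inter> baire_cyl n \<alpha>. f \<beta> \<in> U"
  shows "continuous_map (top_of_set C) T f"
proof -
  have "openin (top_of_set C) {x \<in> C. f x \<in> U}" if "openin T U" for U
  proof (rule iffD2[OF openin_subopen], rule ballI)
    fix \<alpha> assume "\<alpha> \<in> {x \<in> C. f x \<in> U}"
    then have "\<alpha> \<in> C" "f \<alpha> \<in> U" by auto
    with assms(2)[OF that] obtain n where "\<forall>\<beta>\<in>C \<inter> baire_cyl n \<alpha>. f \<beta> \<in> U"
      by blast
    moreover have "openin (top_of_set C) (C \<inter> baire_cyl n \<alpha>)"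
      by (simp add: open_baire_cyl openin_open_Int)
    ultimately show "\<exists>V. openin (top_of_set C) V \<and> \<alpha> \<in> V \<and> V \<subseteq> {x \<in> C. f x \<in> U}"
      using \<open>\<alpha> \<in> C\<close> by (intro exI[of _ "C \<inter> baire_cyl n \<alpha>"]) auto
  qed
  then show ?thesis
    using assms(1) by (auto simp: continuous_map_def)
qed

lemma continuous_map_baireD:
  assumes "continuous_map (top_of_set C) T f" "openin T U" "\<alpha> \<in> C" "f \<alpha> \<in> U"
  obtains n where "f ` (C \<inter> baire_cyl n \<alpha>) \<subseteq> U"
proof -
  have "openin (top_of_set C) {x \<in> C. f x \<in> U}"
    using assms(1,2) by (simp add: continuous_map_def)
  then obtain V where V: "open V" "{x \<in> C. f x \<in> U} = C \<inter> V"
    by (meson openin_open)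
  then have "\<alpha> \<in> V" using assms by blast
  then obtain n where "baire_cyl n \<alpha> \<subseteq> V"
    using open_contains_baire_cyl V(1) by blast
  then have "f ` (C \<inter> baire_cyl n \<alpha>) \<subseteq> U" using V(2) by blast
  then show thesis ..
qed

section \<open>Analytic sets as continuous images of closed subsets of Baire space\<close>

definition analytic_in :: "'a topology \<Rightarrow> 'a set \<Rightarrow> bool" where
  "analytic_in T A \<longleftrightarrow>
     (\<exists>(C :: (nat \<Rightarrow> nat) set) f. closed C \<and> continuous_map (top_of_set C) T f \<and> f ` C = A)"

lemma analytic_inI:
  "closed C \<Longrightarrow> continuous_map (top_of_set C) T f \<Longrightarrow> f ` C = A \<Longrightarrow> analytic_in T A" for C :: "(nat \<Rightarrow> nat) set"
  unfolding analytic_in_def by blast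

lemma analytic_inE:
  assumes "analytic_in T A"
  obtains C :: "(nat \<Rightarrow> nat) set" and f
  where "closed C" "continuous_map (top_of_set C) T f" "f ` C = A"
  using assms unfolding analytic_in_def by blast

lemma analytic_in_subset: "analytic_in T A \<Longrightarrow> A \<subseteq> topspace T"
  unfolding analytic_in_def continuous_map_def by auto

lemma analytic_in_empty [simp]: "analytic_in T {}"
  by (rule analytic_inI[of "{}"]) (auto simp: continuous_map_def)

lemma analytic_in_image:
  assumes "analytic_in T A" "continuous_map T S h"
  shows "analytic_in S (h ` A)"
proof -
  obtain C :: "(nat \<Rightarrow> nat) set" and f where "closed C" "continuous_map (top_of_set C) T f" "f ` C = A"
    using assms(1) by (rule analytic_inE)
  then show ?thesis
    using assms(2) by (intro analytic_inI[of C S "h \<circ> f"] continuous_map_compose) (auto simp: image_comp)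
qed

text \<open>It suffices to shrink the parameter set to a closed preimage. Allowing every closed set
  as parameter set, and not only the whole Baire space, is what makes this immediate; it also admits
  the empty set.\<close>

lemma analytic_in_Int_closedin:
  assumes "analytic_in T A" "closedin T K"
  shows "analytic_in T (A \<inter> K)"
proof -
  obtain C :: "(nat \<Rightarrow> nat) set" and f where C: "closed C" "continuous_map (top_of_set C) T f" "f ` C = A"
    using assms(1) by (rule analytic_inE)
  define D where "D = {\<alpha> \<in> C. f \<alpha> \<in> K}"
  have "closedin (top_of_set C) D"
    using closedin_continuous_map_preimage[OF C(2) assms(2)] by (simp add: D_def)
  then have "closed D"
    using C(1) by (metis closedin_closed_eq)
  moreover have "continuous_map (top_of_set D) T f"
    using C(2) continuous_map_from_subtopology_mono D_def by fastforce
  moreover have "f ` D = A \<inter> K" using C(3) by (auto simp: D_def)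
  ultimately show ?thesis by (rule analytic_inI)
qed

text \<open>The union of a sequence of analytic sets is parametrized by spending coordinate 0 on the index.\<close>

lemma analytic_in_UN:
  fixes A :: "nat \<Rightarrow> 'a set"
  assumes "\<And>i. analytic_in T (A i)"
  shows "analytic_in T (\<Union>i. A i)"
proof -
  obtain C :: "nat \<Rightarrow> (nat \<Rightarrow> nat) set" and f where C: "\<And>i. closed (C i)" "\<And>i. continuous_map (top_of_set (C i)) T (f i)"
    "\<And>i. f i ` C i = A i"
    using assms unfolding analytic_in_def by metis
  define sh where "sh = (\<lambda>\<alpha> :: nat \<Rightarrow> nat. \<lambda>n. \<alpha> (Suc n))"
  define D where "D = {\<alpha>. sh \<alpha> \<in> C (\<alpha> 0)}"
  define g where "g = (\<lambda>\<alpha>. f (\<alpha> 0) (sh \<alpha>))"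
  \<comment> \<open>Agreement on \<open>Suc n\<close> coordinates fixes the index and
    \<open>n\<close> coordinates of the tail. On such a cylinder the choice of
    \<open>C (\<alpha> 0)\<close> and \<open>f (\<alpha> 0)\<close> is constant, so closedness and
    continuity reduce to a single index.\<close>
  have sh: "sh \<beta> \<in> baire_cyl n (sh \<alpha>) \<and> \<beta> 0 = \<alpha> 0" if "\<beta> \<in> baire_cyl (Suc n) \<alpha>" for \<alpha> \<beta> n
    using that by (auto simp: baire_cyl_def sh_def)
  have "closed D"
  proof (rule closed_baireI)
    fix \<alpha> assume *: "\<And>n. \<exists>\<beta>\<in>D. \<beta> \<in> baire_cyl n \<alpha>"
    have "\<exists>\<beta>\<in>C (\<alpha> 0). \<beta> \<in> baire_cyl n (sh \<alpha>)" for n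
      using *[of "Suc n"] sh[of _ n \<alpha>] unfolding D_def by fastforce
    then show "\<alpha> \<in> D" using closed_baireD[OF C(1)] by (auto simp: D_def)
  qed
  moreover have "continuous_map (top_of_set D) T g"
  proof (rule continuous_map_baireI)
    show "g \<in> D \<rightarrow> topspace T"
      using C(2) by (fastforce simp: g_def D_def continuous_map_def)
    fix U \<alpha> assume U: "openin T U" "\<alpha> \<in> D" "g \<alpha> \<in> U"
    then obtain n where "f (\<alpha> 0) ` (C (\<alpha> 0) \<inter> baire_cyl n (sh \<alpha>)) \<subseteq> U"
      using continuous_map_baireD[OF C(2) U(1), of "sh \<alpha>" "\<alpha> 0"] by (auto simp: D_def g_def)
    then have "\<forall>\<beta>\<in>D \<inter> baire_cyl (Suc n) \<alpha>. g \<beta> \<in> U"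
      using sh[of _ n \<alpha>] unfolding D_def g_def by fastforce
    then show "\<exists>n. \<forall>\<beta>\<in>D \<inter> baire_cyl n \<alpha>. g \<beta> \<in> U" ..
  qed
  moreover have "g ` D = (\<Union>i. A i)"
  proof
    show "g ` D \<subseteq> (\<Union>i. A i)" using C(3) by (auto simp: g_def D_def)
    show "(\<Union>i. A i) \<subseteq> g ` D"
    proof
      fix x assume "x \<in> (\<Union>i. A i)"
      then obtain i \<beta> where "\<beta> \<in> C i" "x = f i \<beta>" using C(3) by blast
      then have "case_nat i \<beta> \<in> D" "g (case_nat i \<beta>) = x"
        by (auto simp: D_def g_def sh_def)
      then show "x \<in> g ` D" by blast
    qed
  qed
  ultimately show ?thesis by (rule analytic_inI)
qed

lemma analytic_in_Union:
  assumes "countable \<A>" "\<And>A. A \<in> \<A> \<Longrightarrow> analytic_in T A"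
  shows "analytic_in T (\<Union>\<A>)"
proof (cases "\<A> = {}")
  case False
  then have "\<Union>\<A> = (\<Union>n. from_nat_into \<A> n)"
    using range_from_nat_into[OF False assms(1)] by auto
  then show ?thesis
    using analytic_in_UN[of T "from_nat_into \<A>"] assms(2) from_nat_into[OF False] by simp
qed simp

lemma analytic_in_Un: "analytic_in T A \<Longrightarrow> analytic_in T B \<Longrightarrow> analytic_in T (A \<union> B)"
  using analytic_in_Union[of "{A, B}" T] by auto

text \<open>One point of Baire space is read as an infinite matrix, so that a single parameter can
  carry a whole sequence of parameters.\<close>

definition baire_row :: "nat \<Rightarrow> (nat \<Rightarrow> nat) \<Rightarrow> (nat \<Rightarrow> nat)" where
  "baire_row i \<alpha> = (\<lambda>n. \<alpha> (prod_encode (i, n)))"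

lemma continuous_on_baire_row: "continuous_on S (baire_row i)"
  unfolding baire_row_def
  by (intro continuous_on_coordinatewise_then_product continuous_on_subset[OF continuous_on_product_coordinates]) auto

lemma baire_row_surj: "\<exists>\<alpha>. \<forall>i. baire_row i \<alpha> = a i"
proof (intro exI allI)
  show "baire_row i (\<lambda>k. case prod_decode k of (i, n) \<Rightarrow> a i n) = a i" for i
    by (simp add: baire_row_def)
qed

lemma continuous_map_baire_row:
  assumes "continuous_map (top_of_set C) T f" "baire_row i ` D \<subseteq> C"
  shows "continuous_map (top_of_set D) T (\<lambda>\<alpha>. f (baire_row i \<alpha>))"
proof -
  have "continuous_map (top_of_set D) (top_of_set C) (baire_row i)"
    using assms(2) continuous_on_baire_row by (auto simp: continuous_map_in_subtopology)
  from continuous_map_compose[OF this assms(1)] show ?thesis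
    by (simp add: comp_def)
qed

lemma closed_baire_rows: "(\<And>i. closed (C i)) \<Longrightarrow> closed {\<alpha>. \<forall>i. baire_row i \<alpha> \<in> C i}"
  by (intro closed_Collect_all) (use closed_vimage[OF _ continuous_on_baire_row] in \<open>auto simp: vimage_def\<close>)

text \<open>A common point of all \<open>A i\<close> amounts to a sequence of parameters, one for
  each \<open>i\<close>, with equal values. The equations \<open>g i \<alpha> = g 0 \<alpha>\<close>
  cut out a closed set of coded sequences because \<open>T\<close> is Hausdorff.\<close>

lemma analytic_in_INT:
  fixes A :: "nat \<Rightarrow> 'a set"
  assumes "Hausdorff_space T" "\<And>i. analytic_in T (A i)"
  shows "analytic_in T (\<Inter>i. A i)"
proof -
  obtain C :: "nat \<Rightarrow> (nat \<Rightarrow> nat) set" and f where C: "\<And>i. closed (C i)" "\<And>i. continuous_map (top_of_set (C i)) T (f i)"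
    "\<And>i. f i ` C i = A i"
    using assms(2) unfolding analytic_in_def by metis
  define D where "D = {\<alpha>. \<forall>i. baire_row i \<alpha> \<in> C i}"
  define g where "g = (\<lambda>i \<alpha>. f i (baire_row i \<alpha>))"
  have g: "continuous_map (top_of_set D) T (g i)" for i
    unfolding g_def by (rule continuous_map_baire_row[OF C(2)]) (auto simp: D_def)
  define K where "K = (\<Inter>i. {\<alpha> \<in> D. g i \<alpha> = g 0 \<alpha>})"
  have "closedin (top_of_set D) {\<alpha> \<in> D. g i \<alpha> = g 0 \<alpha>}" for i
    using closedin_continuous_maps_eq[OF assms(1) g g] by simp
  then have "closedin (top_of_set D) K"
    unfolding K_def by (intro closedin_INT) auto
  moreover have "closed D" unfolding D_def by (rule closed_baire_rows[OF C(1)])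
  ultimately have "closed K" by (metis closedin_closed_eq)
  moreover have "K \<subseteq> D" by (auto simp: K_def)
  then have "continuous_map (top_of_set K) T (g 0)"
    using g continuous_map_from_subtopology_mono by blast
  moreover have "g 0 ` K = (\<Inter>i. A i)"
  proof
    show "g 0 ` K \<subseteq> (\<Inter>i. A i)"
    proof safe
      fix \<alpha> i assume "\<alpha> \<in> K"
      then have "g i \<alpha> = g 0 \<alpha>" "\<alpha> \<in> D" by (auto simp: K_def)
      moreover from this(2) have "g i \<alpha> \<in> A i" using C(3)[of i] by (auto simp: g_def D_def)
      ultimately show "g 0 \<alpha> \<in> A i" by simp
    qed
    show "(\<Inter>i. A i) \<subseteq> g 0 ` K"
    proof
      fix x assume "x \<in> (\<Inter>i. A i)"
      then have "\<exists>\<beta>. \<beta> \<in> C i \<and> f i \<beta> = x" for i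
      proof -
        have "x \<in> f i ` C i" using \<open>x \<in> (\<Inter>i. A i)\<close> C(3)[of i] by simp
        then show ?thesis by blast
      qed
      then obtain a where a: "\<And>i. a i \<in> C i" "\<And>i. f i (a i) = x" by metis
      obtain \<alpha> where "\<And>i. baire_row i \<alpha> = a i" using baire_row_surj[of a] by blast
      with a have "\<alpha> \<in> K" "g 0 \<alpha> = x" by (auto simp: K_def D_def g_def)
      then show "x \<in> g 0 ` K" by blast
    qed
  qed
  ultimately show ?thesis by (rule analytic_inI)
qed

lemma analytic_in_Times:
  assumes "analytic_in T A" "analytic_in S B"
  shows "analytic_in (prod_topology T S) (A \<times> B)"
proof -
  obtain C :: "(nat \<Rightarrow> nat) set" and f where C: "closed C" "continuous_map (top_of_set C) T f" "f ` C = A"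
    using assms(1) by (rule analytic_inE)
  obtain D :: "(nat \<Rightarrow> nat) set" and g where D: "closed D" "continuous_map (top_of_set D) S g" "g ` D = B"
    using assms(2) by (rule analytic_inE)
  define K where "K = {\<alpha>. \<forall>i. baire_row i \<alpha> \<in> (if i = 0 then C else D)}"
  have K: "baire_row 0 ` K \<subseteq> C" "baire_row 1 ` K \<subseteq> D"
    by (force simp: K_def split: if_splits)+
  define h where "h = (\<lambda>\<alpha>. (f (baire_row 0 \<alpha>), g (baire_row 1 \<alpha>)))"
  have "closed K" unfolding K_def using C(1) D(1) by (intro closed_baire_rows) auto
  moreover have "continuous_map (top_of_set K) (prod_topology T S) h"
    unfolding h_def
    by (intro continuous_map_pairedI continuous_map_baire_row[OF C(2)] continuous_map_baire_row[OF D(2)] K)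
  moreover have "h ` K = A \<times> B"
  proof
    show "h ` K \<subseteq> A \<times> B" using K C(3) D(3) by (auto simp: h_def)
    show "A \<times> B \<subseteq> h ` K"
    proof
      fix z assume "z \<in> A \<times> B"
      then obtain a b where ab: "a \<in> C" "b \<in> D" "z = (f a, g b)" using C(3) D(3) by blast
      obtain \<alpha> where "\<And>i. baire_row i \<alpha> = (if i = 0 then a else b)"
        using baire_row_surj[of "\<lambda>i. if i = 0 then a else b"] by blast
      with ab have "\<alpha> \<in> K" "h \<alpha> = z" by (auto simp: K_def h_def)
      then show "z \<in> h ` K" by blast
    qed
  qed
  ultimately show ?thesis by (rule analytic_inI)
qed

section \<open>Polish spaces and their Borel sets are analytic\<close>

lemma (in Metric_space) analytic_in_mspace:
  assumes "mcomplete" "separable_space mtopology"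
  shows "analytic_in mtopology M"
proof (cases "M = {}")
  case False
  obtain Q where Q: "countable Q" "Q \<subseteq> M" "mtopology closure_of Q = M"
    using assms(2) unfolding separable_space_def by auto
  have "Q \<noteq> {}" using Q(3) False by auto
  define e where "e = from_nat_into Q"
  have eM: "e n \<in> M" for n
    using from_nat_into[OF \<open>Q \<noteq> {}\<close>] Q(2) by (auto simp: e_def)
  have dense: "\<exists>n. d x (e n) \<le> r" if "x \<in> M" "0 < r" for x r
  proof -
    have "x \<in> mtopology closure_of Q" using that Q(3) by simp
    then obtain y where y: "y \<in> Q" "d x y < r"
      using \<open>0 < r\<close> unfolding metric_closure_of by (auto simp: mball_def)
    then obtain n where "e n = y"
      using Q(1) by (metis e_def from_nat_into_surj)
    with y show ?thesis by (auto intro: exI[of _ n])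
  qed
  \<comment> \<open>A code lists centres from the dense sequence, the \<open>n\<close>-th lying
    within \<open>(1/2) ^ n\<close> of the coded point. The non-strict bound survives limits, and
    this makes the set of codes closed.\<close>
  define near where "near = (\<lambda>\<alpha> x. x \<in> M \<and> (\<forall>n. d x (e (\<alpha> n)) \<le> (1/2) ^ n))"
  define C where "C = {\<alpha>. \<exists>x. near \<alpha> x}"
  define f where "f = (\<lambda>\<alpha>. SOME x. near \<alpha> x)"
  have fn: "near \<alpha> (f \<alpha>)" if "\<alpha> \<in> C" for \<alpha>
    using that unfolding C_def f_def by (auto intro: someI)
  have small: "\<exists>n. 2 * (1/2) ^ n < (r :: real)" if "r > 0" for r
    using real_arch_pow_inv[of "r / 2" "1/2"] that by (auto simp: field_simps)
  \<comment> \<open>Agreement at the single index \<open>n\<close> suffices, by the triangle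
    inequality through the common centre. Uniqueness of the coded point and continuity of the
    decoding both follow from this estimate.\<close>
  have close: "d x y \<le> 2 * (1/2) ^ n" if "near \<alpha> x" "near \<beta> y" "\<alpha> n = \<beta> n" for \<alpha> \<beta> x y n
  proof -
    have "d x y \<le> d x (e (\<alpha> n)) + d (e (\<alpha> n)) y"
      using that eM by (intro triangle) (auto simp: near_def)
    moreover have "d x (e (\<alpha> n)) \<le> (1/2) ^ n"
      using that(1) by (simp add: near_def)
    moreover have "d (e (\<alpha> n)) y \<le> (1/2) ^ n"
      using that(2,3) by (simp add: near_def commute)
    ultimately show ?thesis by simp
  qed
  have uniq: "x = y" if "near \<alpha> x" "near \<alpha> y" for \<alpha> x y
  proof (rule ccontr)
    assume "x \<noteq> y"
    then have "0 < d x y" using that by (auto simp: near_def)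
    with small obtain n where "2 * (1/2) ^ n < d x y" by blast
    with close[OF that, of n] show False by simp
  qed
  have "closed C"
  proof (rule closed_baireI)
    fix \<alpha> assume *: "\<And>n. \<exists>\<beta>\<in>C. \<beta> \<in> baire_cyl n \<alpha>"
    \<comment> \<open>Each finite prefix of \<open>\<alpha>\<close> is realised by a point, taken
      from a code that agrees with \<open>\<alpha>\<close> at \<open>0, ..., n\<close>. These points
      form a Cauchy sequence, and by completeness its limit is coded by \<open>\<alpha>\<close>
      itself.\<close>
    have "\<exists>y\<in>M. \<forall>k\<le>n. d y (e (\<alpha> k)) \<le> (1/2) ^ k" for n
    proof -
      obtain \<beta> where \<beta>: "\<beta> \<in> C" "\<beta> \<in> baire_cyl (Suc n) \<alpha>" using * by blast
      have "d (f \<beta>) (e (\<alpha> k)) \<le> (1/2) ^ k" if "k \<le> n" for k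
      proof -
        have "\<alpha> k = \<beta> k" using \<beta>(2) that by (simp add: baire_cyl_def)
        then show ?thesis using fn[OF \<beta>(1)] by (simp add: near_def)
      qed
      then show ?thesis using fn[OF \<beta>(1)] by (auto simp: near_def)
    qed
    then obtain y where y: "\<And>n. y n \<in> M" "\<And>n k. k \<le> n \<Longrightarrow> d (y n) (e (\<alpha> k)) \<le> (1/2) ^ k"
      by metis
    have yy: "d (y m) (y n) \<le> 2 * (1/2) ^ k" if "k \<le> m" "k \<le> n" for k m n
      using triangle[OF y(1)[of m] eM[of "\<alpha> k"] y(1)[of n]] y(2)[OF that(1)] y(2)[OF that(2)]
      by (simp add: commute)
    have "MCauchy y"
      unfolding MCauchy_def
    proof (intro conjI allI impI)
      show "range y \<subseteq> M" using y(1) by blast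
      fix r :: real assume "0 < r"
      with small obtain k where k: "2 * (1/2) ^ k < r" by blast
      show "\<exists>N. \<forall>n n'. N \<le> n \<longrightarrow> N \<le> n' \<longrightarrow> d (y n) (y n') < r"
        using yy k by (intro exI[of _ k]) (meson le_less_trans)
    qed
    then obtain x where x: "limitin mtopology y x sequentially"
      using assms(1) unfolding mcomplete_def by blast
    have "near \<alpha> x"
      unfolding near_def
    proof (intro conjI allI)
      show "x \<in> M" using x by (simp add: limitin_mspace)
      fix k
      have "x \<in> mcball (e (\<alpha> k)) ((1/2) ^ k)"
      proof (rule limitin_closedin[OF x closedin_mcball])
        show "eventually (\<lambda>n. y n \<in> mcball (e (\<alpha> k)) ((1/2) ^ k)) sequentially"
          using y eM by (auto simp: eventually_sequentially mcball_def commute)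
      qed simp
      then show "d x (e (\<alpha> k)) \<le> (1/2) ^ k" by (simp add: mcball_def commute)
    qed
    then show "\<alpha> \<in> C" by (auto simp: C_def)
  qed
  moreover have "continuous_map (top_of_set C) mtopology f"
  proof (rule continuous_map_baireI)
    show "f \<in> C \<rightarrow> topspace mtopology" using fn by (auto simp: near_def)
    fix U \<alpha> assume U: "openin mtopology U" "\<alpha> \<in> C" "f \<alpha> \<in> U"
    then obtain r where r: "0 < r" "mball (f \<alpha>) r \<subseteq> U"
      using openin_mtopology by blast
    obtain n where n: "2 * (1/2) ^ n < r" using small r(1) by blast
    have "f \<beta> \<in> U" if "\<beta> \<in> C" "\<beta> \<in> baire_cyl (Suc n) \<alpha>" for \<beta>
    proof -
      have "d (f \<alpha>) (f \<beta>) \<le> 2 * (1/2) ^ n"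
        using close[OF fn[OF U(2)] fn[OF that(1)], of n] that(2) by (simp add: baire_cyl_def)
      then have "f \<beta> \<in> mball (f \<alpha>) r"
        using n fn[OF U(2)] fn[OF that(1)] by (auto simp: near_def mball_def)
      then show ?thesis using r(2) by blast
    qed
    then show "\<exists>n. \<forall>\<beta>\<in>C \<inter> baire_cyl n \<alpha>. f \<beta> \<in> U" by blast
  qed
  moreover have "f ` C = M"
  proof
    show "f ` C \<subseteq> M" using fn by (auto simp: near_def)
    show "M \<subseteq> f ` C"
    proof
      fix x assume "x \<in> M"
      then have "\<forall>n. \<exists>k. d x (e k) \<le> (1/2) ^ n" by (auto intro: dense)
      then obtain \<alpha> where "\<And>n. d x (e (\<alpha> n)) \<le> (1/2) ^ n" by metis
      then have "near \<alpha> x" using \<open>x \<in> M\<close> by (simp add: near_def)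
      then show "x \<in> f ` C" using uniq fn[of \<alpha>] by (auto simp: C_def)
    qed
  qed
  ultimately show ?thesis by (rule analytic_inI)
qed simp

lemma polish_analytic_topspace: "polish_topology T \<Longrightarrow> analytic_in T (topspace T)"
  unfolding polish_topology_def completely_metrizable_space_def
  using Metric_space.analytic_in_mspace Metric_space.topspace_mtopology by metis

lemma polish_metrizable: "polish_topology T \<Longrightarrow> metrizable_space T"
  by (simp add: polish_topology_def completely_metrizable_imp_metrizable_space)

lemma polish_analytic_closedin: "polish_topology T \<Longrightarrow> closedin T K \<Longrightarrow> analytic_in T K"
  using analytic_in_Int_closedin[OF polish_analytic_topspace] closedin_subset
  by (metis inf.absorb2)

lemma polish_analytic_openin:
  assumes "polish_topology T" "openin T U"
  shows "analytic_in T U"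
proof -
  have "fsigma_in T U"
    using open_imp_fsigma_in polish_metrizable assms by blast
  then obtain \<K> where "countable \<K>" "\<K> \<subseteq> Collect (closedin T)" "\<Union>\<K> = U"
    unfolding fsigma_in_def union_of_def by auto
  then show ?thesis
    using analytic_in_Union polish_analytic_closedin[OF assms(1)] by blast
qed

text \<open>Analytic sets are not closed under complements in general, so the induction carries a
  set together with its complement; countable unions on one side become countable intersections on
  the other.\<close>

lemma analytic_in_sigma_sets:
  assumes "Hausdorff_space T" "analytic_in T (topspace T)"
    and "\<And>A. A \<in> \<G> \<Longrightarrow> analytic_in T A" "\<And>A. A \<in> \<G> \<Longrightarrow> analytic_in T (topspace T - A)"
    and "A \<in> sigma_sets (topspace T) \<G>"
  shows "analytic_in T A"
proof -
  have "analytic_in T A \<and> analytic_in T (topspace T - A)"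
    using assms(5)
  proof induction
    case (Compl a)
    then show ?case using analytic_in_subset by (metis double_diff order_refl)
  next
    case (Union a)
    have "topspace T - (\<Union>i. a i) = (\<Inter>i. topspace T - a i)" by auto
    then show ?case using Union analytic_in_UN analytic_in_INT[OF assms(1)] by metis
  qed (use assms in auto)
  then show ?thesis ..
qed

text \<open>Standard Borel spaces satisfy the following, and so do their products, for which we need not
  verify that the product topology is Polish or generates the product \<open>\<sigma>\<close>-algebra.\<close>

definition suslin_space :: "'a measure \<Rightarrow> 'a topology \<Rightarrow> bool" where
  "suslin_space M T \<longleftrightarrow>
     space M = topspace T \<and> (\<forall>A\<in>sets M. analytic_in T A) \<and>
     (\<forall>x\<in>space M. \<forall>y\<in>space M. x \<noteq> y \<longrightarrow>
        (\<exists>U\<in>sets M. \<exists>V\<in>sets M. openin T U \<and> openin T V \<and> x \<in> U \<and> y \<in> V \<and> disjnt U V))"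

lemma suslin_space_analytic: "suslin_space M T \<Longrightarrow> A \<in> sets M \<Longrightarrow> analytic_in T A"
  by (simp add: suslin_space_def)

lemma suslin_space_topspace: "suslin_space M T \<Longrightarrow> topspace T = space M"
  by (simp add: suslin_space_def)

lemma suslin_space_separating:
  assumes "suslin_space M T" "x \<in> space M" "y \<in> space M" "x \<noteq> y"
  obtains U V where "U \<in> sets M" "V \<in> sets M" "openin T U" "openin T V" "x \<in> U" "y \<in> V" "disjnt U V"
  using assms unfolding suslin_space_def by blast

lemma suslin_space_Hausdorff: "suslin_space M T \<Longrightarrow> Hausdorff_space T"
  unfolding suslin_space_def Hausdorff_space_def by (simp, metis)

lemma standard_borel_suslin:
  assumes "standard_borel_space M"
  obtains T where "suslin_space M T"
proof -
  obtain T where T: "polish_topology T" "space M = topspace T"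
    "sets M = sigma_sets (topspace T) {U. openin T U}"
    using assms unfolding standard_borel_space_def by blast
  have H: "Hausdorff_space T"
    using T(1) polish_metrizable metrizable_imp_Hausdorff_space by blast
  have "analytic_in T A" if "A \<in> sets M" for A
  proof (rule analytic_in_sigma_sets[OF H polish_analytic_topspace[OF T(1)]])
    show "A \<in> sigma_sets (topspace T) {U. openin T U}" using that T(3) by simp
    show "analytic_in T U" if "U \<in> {U. openin T U}" for U
      using that polish_analytic_openin[OF T(1)] by simp
    show "analytic_in T (topspace T - U)" if "U \<in> {U. openin T U}" for U
      using that by (intro polish_analytic_closedin[OF T(1)]) auto
  qed
  moreover have "openin T U \<Longrightarrow> U \<in> sets M" for U
    using T(3) by auto
  moreover have "\<exists>U V. openin T U \<and> openin T V \<and> x \<in> U \<and> y \<in> V \<and> disjnt U V"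
    if "x \<in> space M" "y \<in> space M" "x \<noteq> y" for x y
    using H that T(2) unfolding Hausdorff_space_def by simp
  ultimately have "suslin_space M T"
    using T(2) unfolding suslin_space_def by meson
  then show thesis by (rule that)
qed

text \<open>Rectangles generate the product, and the complement of a rectangle is a union of two
  rectangles, so all measurable sets are analytic. Distinct pairs differ in a coordinate and are
  separated by open rectangles with measurable sides; arbitrary open sets of the product topology
  are not assumed measurable.\<close>

lemma suslin_space_pair:
  assumes M: "suslin_space M T" and N: "suslin_space N S"
  shows "suslin_space (M \<Otimes>\<^sub>M N) (prod_topology T S)"
proof -
  note top = suslin_space_topspace[OF M] suslin_space_topspace[OF N]
  have "openin T (space M)" "openin S (space N)" by (simp_all flip: top)
  note top = top this
  have H: "Hausdorff_space (prod_topology T S)"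
    using suslin_space_Hausdorff[OF M] suslin_space_Hausdorff[OF N]
    by (simp add: Hausdorff_space_prod_topology)
  have an: "analytic_in (prod_topology T S) (A \<times> B)" if "A \<in> sets M" "B \<in> sets N" for A B
    by (intro analytic_in_Times suslin_space_analytic[OF M] suslin_space_analytic[OF N] that)
  have "analytic_in (prod_topology T S) A" if "A \<in> sets (M \<Otimes>\<^sub>M N)" for A
  proof (rule analytic_in_sigma_sets[OF H])
    show "analytic_in (prod_topology T S) (topspace (prod_topology T S))"
      using an[OF sets.top sets.top] by (simp add: top)
    show "A \<in> sigma_sets (topspace (prod_topology T S)) {a \<times> b |a b. a \<in> sets M \<and> b \<in> sets N}"
      using that by (simp add: sets_pair_measure top)
    fix B assume "B \<in> {a \<times> b |a b. a \<in> sets M \<and> b \<in> sets N}"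
    then obtain a b where B: "B = a \<times> b" "a \<in> sets M" "b \<in> sets N" by blast
    then show "analytic_in (prod_topology T S) B" by (simp add: an)
    have "topspace (prod_topology T S) - B = (space M - a) \<times> space N \<union> space M \<times> (space N - b)"
      using B(1) by (auto simp: top)
    then show "analytic_in (prod_topology T S) (topspace (prod_topology T S) - B)"
      using B by (auto intro!: analytic_in_Un an)
  qed
  moreover have "\<exists>U\<in>sets (M \<Otimes>\<^sub>M N). \<exists>V\<in>sets (M \<Otimes>\<^sub>M N). openin (prod_topology T S) U \<and>
      openin (prod_topology T S) V \<and> z \<in> U \<and> w \<in> V \<and> disjnt U V"
    if zw: "z \<in> space (M \<Otimes>\<^sub>M N)" "w \<in> space (M \<Otimes>\<^sub>M N)" "z \<noteq> w" for z w
  proof -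
    obtain x y x' y' where xy: "z = (x, y)" "w = (x', y')" by fastforce
    consider "x \<noteq> x'" | "y \<noteq> y'" using zw xy by auto
    then show ?thesis
    proof cases
      case 1
      moreover have "x \<in> space M" "x' \<in> space M" using zw xy by (auto simp: space_pair_measure)
      ultimately obtain U V where "U \<in> sets M" "V \<in> sets M" "openin T U" "openin T V" "x \<in> U" "x' \<in> V" "disjnt U V"
        by (metis suslin_space_separating[OF M])
      then show ?thesis
        using xy zw
        by - (rule bexI[of _ "U \<times> space N"], rule bexI[of _ "V \<times> space N"],
          auto simp: space_pair_measure openin_prod_Times_iff disjnt_def top)
    next
      case 2
      moreover have "y \<in> space N" "y' \<in> space N" using zw xy by (auto simp: space_pair_measure)
      ultimately obtain U V where "U \<in> sets N" "V \<in> sets N" "openin S U" "openin S V" "y \<in> U" "y' \<in> V" "disjnt U V"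
        by (metis suslin_space_separating[OF N])
      then show ?thesis
        using xy zw
        by - (rule bexI[of _ "space M \<times> U"], rule bexI[of _ "space M \<times> V"],
          auto simp: space_pair_measure openin_prod_Times_iff disjnt_def top)
    qed
  qed
  ultimately show ?thesis
    unfolding suslin_space_def by (simp add: space_pair_measure top)
qed

section \<open>Lusin separation\<close>

definition separated_by :: "'a set set \<Rightarrow> 'a set \<Rightarrow> 'a set \<Rightarrow> bool" where
  "separated_by \<S> A B \<longleftrightarrow> (\<exists>S\<in>\<S>. A \<subseteq> S \<and> S \<inter> B = {})"

text \<open>The separators are intersected over \<open>j\<close> and then united over
  \<open>i\<close>. Read contrapositively: if two countable unions cannot be separated, then some
  piece of one cannot be separated from some piece of the other.\<close>

lemma separated_by_UN:
  fixes A B :: "nat \<Rightarrow> 'a set"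
  assumes "\<And>i j. separated_by (sets M) (A i) (B j)"
  shows "separated_by (sets M) (\<Union>i. A i) (\<Union>j. B j)"
proof -
  obtain S where S: "\<And>i j. S i j \<in> sets M" "\<And>i j. A i \<subseteq> S i j" "\<And>i j. S i j \<inter> B j = {}"
    using assms unfolding separated_by_def by metis
  show ?thesis
    unfolding separated_by_def
  proof (intro bexI[of _ "\<Union>i. \<Inter>j. S i j"] conjI)
    show "(\<Union>i. \<Inter>j. S i j) \<in> sets M" using S(1) by auto
    show "(\<Union>i. A i) \<subseteq> (\<Union>i. \<Inter>j. S i j)"
      by (intro UN_mono INT_greatest S(2)) simp
    have "x \<notin> B j" if "x \<in> S i j" for x i j
      using S(3)[of i j] that by blast
    then show "(\<Union>i. \<Inter>j. S i j) \<inter> (\<Union>j. B j) = {}"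
      by blast
  qed
qed

text \<open>If separation fails, splitting cylinders again and again yields parameters
  \<open>\<alpha>\<close> and \<open>\<beta>\<close> such that the images of their cylinders are
  inseparable at every length. But \<open>f \<alpha>\<close> and \<open>g \<beta>\<close> are
  distinct points, and by continuity their disjoint neighbourhoods separate the images of long
  enough cylinders.\<close>

lemma lusin_separation:
  assumes M: "suslin_space M T" and AB: "analytic_in T A" "analytic_in T B" "A \<inter> B = {}"
  shows "separated_by (sets M) A B"
proof (rule ccontr)
  assume "\<not> separated_by (sets M) A B"
  obtain C :: "(nat \<Rightarrow> nat) set" and f where C: "closed C" "continuous_map (top_of_set C) T f" "f ` C = A"
    using AB(1) by (rule analytic_inE)
  obtain D :: "(nat \<Rightarrow> nat) set" and g where D: "closed D" "continuous_map (top_of_set D) T g" "g ` D = B"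
    using AB(2) by (rule analytic_inE)
  define sep where "sep = (\<lambda>n \<alpha> \<beta>. separated_by (sets M) (f ` (C \<inter> baire_cyl n \<alpha>)) (g ` (D \<inter> baire_cyl n \<beta>)))"
  have split: "baire_cyl n \<alpha> = (\<Union>k. baire_cyl (Suc n) (\<alpha>(n := k)))" for n \<alpha>
    by (auto simp: baire_cyl_def less_Suc_eq)
  have step: "\<exists>k l. \<not> sep (Suc n) (\<alpha>(n := k)) (\<beta>(n := l))" if "\<not> sep n \<alpha> \<beta>" for n \<alpha> \<beta>
  proof (rule ccontr)
    assume "\<not> (\<exists>k l. \<not> sep (Suc n) (\<alpha>(n := k)) (\<beta>(n := l)))"
    then have "separated_by (sets M) (\<Union>k. f ` (C \<inter> baire_cyl (Suc n) (\<alpha>(n := k))))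
        (\<Union>l. g ` (D \<inter> baire_cyl (Suc n) (\<beta>(n := l))))"
      by (intro separated_by_UN) (auto simp: sep_def)
    moreover have "f ` (C \<inter> baire_cyl n \<alpha>) = (\<Union>k. f ` (C \<inter> baire_cyl (Suc n) (\<alpha>(n := k))))"
      "g ` (D \<inter> baire_cyl n \<beta>) = (\<Union>l. g ` (D \<inter> baire_cyl (Suc n) (\<beta>(n := l))))"
      unfolding split[of n \<alpha>] split[of n \<beta>] by blast+
    ultimately have "sep n \<alpha> \<beta>"
      unfolding sep_def by (simp only:)
    with that show False by simp
  qed
  have "\<exists>s. \<forall>n. \<not> sep n (fst (s n)) (snd (s n)) \<and>
      (\<exists>k l. s (Suc n) = ((fst (s n))(n := k), (snd (s n))(n := l)))"
  proof (rule dependent_nat_choice)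
    show "\<exists>x. \<not> sep 0 (fst x) (snd x)"
      using \<open>\<not> separated_by (sets M) A B\<close> C(3) D(3) by (simp add: sep_def baire_cyl_def)
    show "\<exists>y. \<not> sep (Suc n) (fst y) (snd y) \<and> (\<exists>k l. y = ((fst x)(n := k), (snd x)(n := l)))"
      if "\<not> sep n (fst x) (snd x)" for x n
      using step[OF that] by fastforce
  qed
  then obtain s where s: "\<And>n. \<not> sep n (fst (s n)) (snd (s n))"
    "\<And>n. \<exists>k l. s (Suc n) = ((fst (s n))(n := k), (snd (s n))(n := l))" by blast
  \<comment> \<open>Stage \<open>n\<close> rewrites coordinate \<open>n\<close> only, so coordinate
    \<open>i\<close> is final from stage \<open>Suc i\<close> on and the diagonal sequences below
    are the limits.\<close>
  have stab: "fst (s (Suc i + m)) i = fst (s (Suc i)) i \<and> snd (s (Suc i + m)) i = snd (s (Suc i)) i" for i m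
  proof (induction m)
    case (Suc m)
    obtain k l where "s (Suc (Suc i + m)) = ((fst (s (Suc i + m)))(Suc i + m := k), (snd (s (Suc i + m)))(Suc i + m := l))"
      using s(2) by blast
    with Suc show ?case by simp
  qed simp
  define \<alpha> where "\<alpha> = (\<lambda>i. fst (s (Suc i)) i)"
  define \<beta> where "\<beta> = (\<lambda>i. snd (s (Suc i)) i)"
  have "fst (s n) i = \<alpha> i \<and> snd (s n) i = \<beta> i" if "i < n" for n i
    using stab[of i "n - Suc i"] that by (simp add: \<alpha>_def \<beta>_def)
  then have "baire_cyl n (fst (s n)) = baire_cyl n \<alpha>" "baire_cyl n (snd (s n)) = baire_cyl n \<beta>" for n
    by (simp_all cong: baire_cyl_cong)
  then have nsep: "\<not> sep n \<alpha> \<beta>" for n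
    using s(1)[of n] by (simp add: sep_def)
  have AB_sub: "A \<subseteq> space M" "B \<subseteq> space M"
    using AB(1,2)[THEN analytic_in_subset] by (simp_all add: suslin_space_topspace[OF M])
  \<comment> \<open>Empty pieces are trivially separable. Hence every cylinder around
    \<open>\<alpha>\<close> meets \<open>C\<close>, every cylinder around \<open>\<beta>\<close>
    meets \<open>D\<close>, and closedness puts the limits into the parameter sets.\<close>
  have "sep n \<alpha> \<beta>" if "C \<inter> baire_cyl n \<alpha> = {}" for n
    using that by (auto simp: sep_def separated_by_def)
  moreover have "sep n \<alpha> \<beta>" if "D \<inter> baire_cyl n \<beta> = {}" for n
    using that AB_sub(1) C(3) by (auto simp: sep_def separated_by_def)
  ultimately have "\<exists>\<gamma>\<in>C. \<gamma> \<in> baire_cyl n \<alpha>" "\<exists>\<gamma>\<in>D. \<gamma> \<in> baire_cyl n \<beta>" for n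
    using nsep[of n] by fastforce+
  then have "\<alpha> \<in> C" "\<beta> \<in> D"
    using closed_baireD[OF C(1)] closed_baireD[OF D(1)] by simp_all
  then have "f \<alpha> \<in> A" "g \<beta> \<in> B"
    using C(3) D(3) by auto
  then have "f \<alpha> \<noteq> g \<beta>" "f \<alpha> \<in> space M" "g \<beta> \<in> space M"
    using AB(3) AB_sub by auto
  then obtain U V where UV: "U \<in> sets M" "openin T U" "openin T V" "f \<alpha> \<in> U" "g \<beta> \<in> V" "disjnt U V"
    by (metis suslin_space_separating[OF M])
  obtain m where m: "f ` (C \<inter> baire_cyl m \<alpha>) \<subseteq> U"
    using continuous_map_baireD[OF C(2) UV(2) \<open>\<alpha> \<in> C\<close> UV(4)] by blast
  obtain n where n: "g ` (D \<inter> baire_cyl n \<beta>) \<subseteq> V"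
    using continuous_map_baireD[OF D(2) UV(3) \<open>\<beta> \<in> D\<close> UV(5)] by blast
  have "baire_cyl (max m n) \<alpha> \<subseteq> baire_cyl m \<alpha>" "baire_cyl (max m n) \<beta> \<subseteq> baire_cyl n \<beta>"
    by (auto simp: baire_cyl_def)
  with m n have "f ` (C \<inter> baire_cyl (max m n) \<alpha>) \<subseteq> U" "g ` (D \<inter> baire_cyl (max m n) \<beta>) \<subseteq> V"
    by blast+
  with UV(1,6) have "sep (max m n) \<alpha> \<beta>"
    unfolding sep_def separated_by_def disjnt_def by (intro bexI[of _ U] conjI) auto
  with nsep show False by blast
qed

text \<open>Both projections are analytic, being continuous images. As they partition the space, a
  Borel set separating them can only be the first one.\<close>

lemma suslin_projection:
  assumes M: "suslin_space M T" and N: "suslin_space N S"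
    and P: "P \<in> sets (M \<Otimes>\<^sub>M N)" and Q: "Q \<in> sets (M \<Otimes>\<^sub>M N)"
    and "fst ` P \<inter> fst ` Q = {}" "fst ` P \<union> fst ` Q = space M"
  shows "fst ` P \<in> sets M"
proof -
  have "analytic_in T (fst ` R)" if "R \<in> sets (M \<Otimes>\<^sub>M N)" for R
    using suslin_space_analytic[OF suslin_space_pair[OF M N] that] continuous_map_fst
    by (rule analytic_in_image)
  then have "separated_by (sets M) (fst ` P) (fst ` Q)"
    using lusin_separation[OF M] P Q assms(5) by blast
  then obtain Z where Z: "Z \<in> sets M" "fst ` P \<subseteq> Z" "Z \<inter> fst ` Q = {}"
    unfolding separated_by_def by blast
  moreover have "Z \<subseteq> fst ` P \<union> fst ` Q"
    using sets.sets_into_space[OF Z(1)] assms(6) by simp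
  moreover have "Z = A" if "A \<subseteq> Z" "Z \<inter> B = {}" "Z \<subseteq> A \<union> B" for A B
    using that by blast
  ultimately have "Z = fst ` P" by simp
  with Z(1) show ?thesis by simp
qed

section \<open>Borel relations on a quotient Borel space\<close>

locale quotient_borel =
  fixes X :: "'a measure" and E :: "('a \<times> 'a) set" and T :: "'a topology"
  assumes suslin: "suslin_space X T"
    and equiv: "equiv (space X) E"
    and E_sets: "E \<in> sets (X \<Otimes>\<^sub>M X)"
begin

abbreviation "S \<equiv> space X // E"

definition lift :: "'a set set \<Rightarrow> 'a set" where
  "lift A = {x \<in> space X. E `` {x} \<in> A}"

definition lift2 :: "('a set \<times> 'a set) set \<Rightarrow> ('a \<times> 'a) set" where
  "lift2 R = {(x, y). x \<in> space X \<and> y \<in> space X \<and> (E `` {x}, E `` {y}) \<in> R}"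

abbreviation "bset A \<equiv> quotient_borel_set X E A"

abbreviation "brel R \<equiv> borel_relation X E X E R"

lemma bset_iff: "bset A \<longleftrightarrow> A \<subseteq> S \<and> lift A \<in> sets X"
  by (simp add: quotient_borel_set_def lift_def)

text \<open>A rectangle with nonempty sides determines its sides, so passing from pairs of classes
  to classes of \<open>prod_equiv E E\<close> loses nothing.\<close>

lemma brel_iff: "brel R \<longleftrightarrow> R \<subseteq> S \<times> S \<and> lift2 R \<in> sets (X \<Otimes>\<^sub>M X)"
proof (cases "R \<subseteq> S \<times> S")
  case True
  let ?R = "(\<lambda>(C, D). C \<times> D) ` R"
  have ne: "C \<noteq> {}" if "C \<in> S" for C
    using that equiv in_quotient_imp_non_empty by blast
  have "C \<times> D \<in> (space X \<times> space X) // prod_equiv E E" if "C \<in> S" "D \<in> S" for C D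
  proof -
    obtain x y where "x \<in> space X" "y \<in> space X" "C = E `` {x}" "D = E `` {y}"
      using \<open>C \<in> S\<close> \<open>D \<in> S\<close> by (auto elim!: quotientE)
    then show ?thesis
      using quotientI[of "(x, y)" "space X \<times> space X" "prod_equiv E E"]
      by (simp add: prod_equiv_class)
  qed
  then have sub: "?R \<subseteq> space (X \<Otimes>\<^sub>M X) // prod_equiv E E"
    using True by (auto simp: space_pair_measure)
  have mem: "E `` {x} \<times> E `` {y} \<in> ?R \<longleftrightarrow> (E `` {x}, E `` {y}) \<in> R" if "x \<in> space X" "y \<in> space X" for x y
  proof
    assume "E `` {x} \<times> E `` {y} \<in> ?R"
    then obtain C D where CD: "(C, D) \<in> R" "E `` {x} \<times> E `` {y} = C \<times> D" by auto
    then have "C \<noteq> {}" "D \<noteq> {}" using True ne by auto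
    with CD have "C = E `` {x}" "D = E `` {y}" by (auto simp: times_eq_iff)
    with CD show "(E `` {x}, E `` {y}) \<in> R" by simp
  qed force
  have "z \<in> space (X \<Otimes>\<^sub>M X) \<and> prod_equiv E E `` {z} \<in> ?R \<longleftrightarrow> z \<in> lift2 R" for z
  proof -
    obtain x y where z: "z = (x, y)" by fastforce
    show ?thesis
      using mem[of x y] unfolding z
      by (simp only: space_pair_measure lift2_def prod_equiv_class mem_Sigma_iff mem_Collect_eq split_conv) blast
  qed
  then have "{z \<in> space (X \<Otimes>\<^sub>M X). prod_equiv E E `` {z} \<in> ?R} = lift2 R"
    by (intro Set.set_eqI) (simp only: mem_Collect_eq)
  then show ?thesis
    using True sub by (simp add: borel_relation_def quotient_borel_set_def)
qed (simp add: borel_relation_def)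

lemma class_in_S: "x \<in> space X \<Longrightarrow> E `` {x} \<in> S"
  by (rule quotientI)

lemma S_cases: "C \<in> S \<Longrightarrow> (\<And>x. x \<in> space X \<Longrightarrow> C = E `` {x} \<Longrightarrow> thesis) \<Longrightarrow> thesis"
  by (auto elim: quotientE)

lemma bset_S [simp, intro]: "bset S"
proof -
  have "lift S = space X" by (auto simp: lift_def class_in_S)
  then show ?thesis by (simp add: bset_iff)
qed

lemma bset_Diff: "bset A \<Longrightarrow> bset B \<Longrightarrow> bset (A - B)"
proof -
  assume "bset A" "bset B"
  moreover have "lift (A - B) = lift A - lift B" by (auto simp: lift_def)
  ultimately show ?thesis by (auto simp: bset_iff)
qed

lemma bset_Int: "bset A \<Longrightarrow> bset B \<Longrightarrow> bset (A \<inter> B)"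
proof -
  assume "bset A" "bset B"
  moreover have "lift (A \<inter> B) = lift A \<inter> lift B" by (auto simp: lift_def)
  ultimately show ?thesis by (auto simp: bset_iff)
qed

lemma bset_INT: "(\<And>n :: nat. bset (A n)) \<Longrightarrow> bset (\<Inter>n. A n)"
proof -
  assume *: "\<And>n. bset (A n)"
  moreover have "lift (\<Inter>n. A n) = (\<Inter>n. lift (A n))" by (auto simp: lift_def)
  moreover have "(\<Inter>n. A n) \<subseteq> S" using * unfolding bset_iff by blast
  ultimately show ?thesis by (auto simp: bset_iff)
qed

lemma lift_space: "lift A \<subseteq> space X"
  by (auto simp: lift_def)

lemma brel_Un: "brel R \<Longrightarrow> brel Q \<Longrightarrow> brel (R \<union> Q)"
proof -
  assume "brel R" "brel Q"
  moreover have "lift2 (R \<union> Q) = lift2 R \<union> lift2 Q" by (auto simp: lift2_def)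
  ultimately show ?thesis by (auto simp: brel_iff)
qed

lemma brel_Int: "brel R \<Longrightarrow> brel Q \<Longrightarrow> brel (R \<inter> Q)"
proof -
  assume "brel R" "brel Q"
  moreover have "lift2 (R \<inter> Q) = lift2 R \<inter> lift2 Q" by (auto simp: lift2_def)
  ultimately show ?thesis by (auto simp: brel_iff)
qed

lemma brel_Diff: "brel R \<Longrightarrow> brel Q \<Longrightarrow> brel (R - Q)"
proof -
  assume "brel R" "brel Q"
  moreover have "lift2 (R - Q) = lift2 R - lift2 Q" by (auto simp: lift2_def)
  ultimately show ?thesis by (auto simp: brel_iff)
qed

lemma brel_Times: "bset A \<Longrightarrow> bset B \<Longrightarrow> brel (A \<times> B)"
proof -
  assume "bset A" "bset B"
  moreover have "lift2 (A \<times> B) = lift A \<times> lift B" by (auto simp: lift2_def lift_def)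
  ultimately show ?thesis by (auto simp: brel_iff bset_iff)
qed

lemma brel_converse: "brel R \<Longrightarrow> brel (R\<inverse>)"
proof -
  assume R: "brel R"
  have "lift2 (R\<inverse>) = (\<lambda>(x, y). (y, x)) -` lift2 R \<inter> space (X \<Otimes>\<^sub>M X)"
    by (auto simp: lift2_def space_pair_measure)
  also have "\<dots> \<in> sets (X \<Otimes>\<^sub>M X)"
    by (rule measurable_sets[OF measurable_pair_swap']) (use R in \<open>simp add: brel_iff\<close>)
  finally show ?thesis using R by (auto simp: brel_iff)
qed

text \<open>The diagonal of the quotient pulls back to \<open>E\<close> itself, so this is exactly
  the Borelness of \<open>E\<close>.\<close>

lemma brel_Id: "brel (Id_on S)"
proof -
  have "lift2 (Id_on S) = E"
    using equiv equiv_class_eq_iff[OF equiv] by (auto simp: lift2_def class_in_S Id_on_iff)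
  then show ?thesis using E_sets by (auto simp: brel_iff)
qed

lemma brel_Id_on: "bset A \<Longrightarrow> brel (Id_on A)"
proof -
  assume A: "bset A"
  then have "Id_on A = Id_on S \<inter> A \<times> S" by (auto simp: bset_iff)
  then show ?thesis using brel_Int[OF brel_Id brel_Times[OF A bset_S]] by simp
qed

lemma brel_restrict: "brel R \<Longrightarrow> bset A \<Longrightarrow> brel (R \<inter> A \<times> UNIV)"
proof -
  assume R: "brel R" and A: "bset A"
  then have "R \<inter> A \<times> UNIV = R \<inter> A \<times> S" by (auto simp: brel_iff)
  then show ?thesis using brel_Int[OF R brel_Times[OF A bset_S]] by simp
qed

text \<open>For a functional relation \<open>R\<close>, membership in the domain of \<open>R \<inter> Q\<close> can be expressed both by an existential
  and by a universal quantifier over the values of \<open>R\<close>, so that Lusin separation applies.\<close>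

lemma bset_Domain_Int:
  assumes R: "brel R" "single_valued R" "bset (Domain R)" and Q: "brel Q"
  shows "bset (Domain (R \<inter> Q))"
proof -
  have RS: "R \<subseteq> S \<times> S" using R(1) by (simp add: brel_iff)
  define P1 where "P1 = lift2 (R \<inter> Q)"
  \<comment> \<open>Witnesses for the complement: either the unique \<open>R\<close>-value of
    \<open>x\<close> is not a \<open>Q\<close>-value, or \<open>x\<close> lies outside the domain of
    \<open>R\<close> and any second coordinate will do.\<close>
  define P2 where "P2 = lift2 (R - Q) \<union> (space X - lift (Domain R)) \<times> space X"
  have P1: "fst ` P1 = lift (Domain (R \<inter> Q))"
  proof (intro equalityI subsetI)
    fix x assume "x \<in> lift (Domain (R \<inter> Q))"
    then obtain D where x: "x \<in> space X" "(E `` {x}, D) \<in> R \<inter> Q" by (auto simp: lift_def)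
    with RS obtain y where "y \<in> space X" "D = E `` {y}" by (auto elim: S_cases)
    with x have "(x, y) \<in> P1" by (simp add: P1_def lift2_def)
    then show "x \<in> fst ` P1" by force
  qed (auto simp: P1_def lift2_def lift_def)
  have P2: "fst ` P2 = space X - lift (Domain (R \<inter> Q))"
  proof (intro equalityI subsetI)
    fix x assume x: "x \<in> space X - lift (Domain (R \<inter> Q))"
    show "x \<in> fst ` P2"
    proof (cases "x \<in> lift (Domain R)")
      case True
      with x obtain D where D: "(E `` {x}, D) \<in> R - Q" by (auto simp: lift_def)
      with RS obtain y where "y \<in> space X" "D = E `` {y}" by (auto elim: S_cases)
      with x D have "(x, y) \<in> P2" by (simp add: P2_def lift2_def)
      then show ?thesis by force
    next
      case False
      with x have "(x, x) \<in> P2" by (simp add: P2_def)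
      then show ?thesis by force
    qed
  next
    fix x assume "x \<in> fst ` P2"
    then obtain y where "(x, y) \<in> P2" by auto
    then show "x \<in> space X - lift (Domain (R \<inter> Q))"
      using R(2) by (auto simp: P2_def lift2_def lift_def single_valued_def)
  qed
  have "fst ` P1 \<in> sets X"
  proof (rule suslin_projection[OF suslin suslin])
    show "P1 \<in> sets (X \<Otimes>\<^sub>M X)"
      using brel_Int[OF R(1) Q] by (simp add: P1_def brel_iff)
    show "P2 \<in> sets (X \<Otimes>\<^sub>M X)"
      using brel_Diff[OF R(1) Q] R(3) by (auto simp: P2_def brel_iff bset_iff)
    show "fst ` P1 \<inter> fst ` P2 = {}" "fst ` P1 \<union> fst ` P2 = space X"
      using lift_space by (auto simp: P1 P2)
  qed
  then show ?thesis
    using RS by (auto simp: bset_iff P1)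
qed

text \<open>Since \<open>R\<close> is a total function, the complement of \<open>R O Q\<close> is
  \<open>R O (S \<times> S - Q)\<close>. Both are thus projections of Borel sets along the
  intermediate point.\<close>

lemma brel_relcomp:
  assumes R: "brel R" "single_valued R" "Domain R = S" and Q: "brel Q"
  shows "brel (R O Q)"
proof -
  have RS: "R \<subseteq> S \<times> S" and QS: "Q \<subseteq> S \<times> S" using R(1) Q by (simp_all add: brel_iff)
  let ?M = "(X \<Otimes>\<^sub>M X) \<Otimes>\<^sub>M X"
  \<comment> \<open>Triples are arranged as \<open>((x, z), y)\<close>, with the intermediate point
    last, so that \<open>fst\<close> removes it.\<close>
  define P where "P = (\<lambda>Z. {p \<in> space ?M. (fst (fst p), snd p) \<in> lift2 R \<and> (snd p, snd (fst p)) \<in> lift2 Z})"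
  have meas: "P Z \<in> sets ?M" if "brel Z" for Z
  proof -
    have [measurable]: "lift2 R \<in> sets (X \<Otimes>\<^sub>M X)" "lift2 Z \<in> sets (X \<Otimes>\<^sub>M X)"
      using R(1) that by (simp_all add: brel_iff)
    show ?thesis unfolding P_def by measurable
  qed
  have fstP: "fst ` P Z = lift2 (R O Z)" for Z
  proof (intro equalityI subsetI)
    fix p assume "p \<in> lift2 (R O Z)"
    then obtain x z D where p: "p = (x, z)" "x \<in> space X" "z \<in> space X" "(E `` {x}, D) \<in> R" "(D, E `` {z}) \<in> Z"
      by (auto simp: lift2_def)
    with RS obtain y where "y \<in> space X" "D = E `` {y}" by (auto elim: S_cases)
    with p have "((x, z), y) \<in> P Z" by (simp add: P_def lift2_def space_pair_measure)
    then show "p \<in> fst ` P Z" using p(1) by force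
  qed (auto simp: P_def lift2_def space_pair_measure)
  have SQ: "brel (S \<times> S - Q)" using brel_Diff[OF brel_Times Q] by simp
  have "fst ` P Q \<in> sets (X \<Otimes>\<^sub>M X)"
  proof (rule suslin_projection[OF suslin_space_pair[OF suslin suslin] suslin])
    show "P Q \<in> sets ?M" "P (S \<times> S - Q) \<in> sets ?M" by (rule meas Q SQ)+
    show "fst ` P Q \<inter> fst ` P (S \<times> S - Q) = {}"
      unfolding fstP using R(2) by (auto simp: lift2_def single_valued_def)
    have "(x, z) \<in> lift2 (R O Q) \<union> lift2 (R O (S \<times> S - Q))" if "x \<in> space X" "z \<in> space X" for x z
    proof -
      have "E `` {x} \<in> Domain R" using that R(3) class_in_S by simp
      then obtain D where D: "(E `` {x}, D) \<in> R" by blast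
      then have "D \<in> S" using RS by blast
      with D that show ?thesis by (auto simp: lift2_def class_in_S)
    qed
    then show "fst ` P Q \<union> fst ` P (S \<times> S - Q) = space (X \<Otimes>\<^sub>M X)"
      unfolding fstP by (auto simp: space_pair_measure lift2_def)
  qed
  then show ?thesis
    using RS QS by (auto simp: brel_iff fstP)
qed

section \<open>Partial Borel bijections and their extension to automorphisms\<close>

definition pbij :: "('a set \<times> 'a set) set \<Rightarrow> bool" where
  "pbij R \<longleftrightarrow> brel R \<and> single_valued R \<and> single_valued (R\<inverse>) \<and> bset (Domain R) \<and> bset (Range R)"

lemma pbij_converse: "pbij R \<Longrightarrow> pbij (R\<inverse>)"
  by (simp add: pbij_def brel_converse)

lemma pbij_subset: "pbij R \<Longrightarrow> R \<subseteq> S \<times> S"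
  by (simp add: pbij_def brel_iff)

lemma bset_pbij_vimage:
  assumes "pbij R" "bset A"
  shows "bset (R\<inverse> `` A)"
proof -
  have "R\<inverse> `` A = Domain (R \<inter> S \<times> A)"
    using pbij_subset[OF assms(1)] by blast
  then show ?thesis
    using assms bset_Domain_Int[of R "S \<times> A"] brel_Times[OF bset_S assms(2)] by (simp add: pbij_def)
qed

lemma bset_pbij_image: "pbij R \<Longrightarrow> bset A \<Longrightarrow> bset (R `` A)"
  using bset_pbij_vimage[OF pbij_converse] by simp

lemma pbij_restrict:
  assumes "pbij R" "bset A"
  shows "pbij (R \<inter> A \<times> UNIV)"
proof -
  have "Domain (R \<inter> A \<times> UNIV) = Domain R \<inter> A" "Range (R \<inter> A \<times> UNIV) = R `` A" by auto
  moreover have "single_valued (R \<inter> A \<times> UNIV)" "single_valued ((R \<inter> A \<times> UNIV)\<inverse>)"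
    using assms(1) single_valued_subset[of "R \<inter> A \<times> UNIV" R]
      single_valued_subset[of "(R \<inter> A \<times> UNIV)\<inverse>" "R\<inverse>"]
    unfolding pbij_def by blast+
  ultimately show ?thesis
    using assms bset_Int brel_restrict bset_pbij_image[OF assms] by (simp add: pbij_def)
qed

definition autrel :: "('a set \<times> 'a set) set \<Rightarrow> bool" where
  "autrel R \<longleftrightarrow> brel R \<and> single_valued R \<and> single_valued (R\<inverse>) \<and> Domain R = S \<and> Range R = S"

text \<open>Disjointness means that no point has both an \<open>R\<close>-image and an
  \<open>R\<close>-preimage, so \<open>R \<union> R\<inverse>\<close> is still functional. The
  result is its own converse, hence an involution.\<close>

lemma autrel_swap:
  assumes R: "pbij R" and dis: "Domain R \<inter> Range R = {}"
  shows "autrel (R \<union> R\<inverse> \<union> Id_on (S - Domain R - Range R))" (is "autrel ?Q")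
proof -
  have sv: "b = c" if "(a, b) \<in> R" "(a, c) \<in> R" for a b c
    using R that by (auto simp: pbij_def single_valued_def)
  have sv': "b = c" if "(b, a) \<in> R" "(c, a) \<in> R" for a b c
    using R that by (auto simp: pbij_def single_valued_def)
  have dis': "False" if "(a, b) \<in> R" "(c, a) \<in> R" for a b c
    using dis that by blast
  have "brel ?Q"
    using R by (intro brel_Un brel_converse brel_Id_on bset_Diff) (auto simp: pbij_def)
  moreover have "single_valued ?Q"
    unfolding single_valued_def by (auto dest: sv sv' dis')
  moreover have "?Q\<inverse> = ?Q" by auto
  moreover have "Domain ?Q = S" "Range ?Q = S" using pbij_subset[OF R] by auto
  ultimately show ?thesis by (simp add: autrel_def)
qed

lemma autrel_fill:
  assumes R: "pbij R" and eq: "Domain R = Range R"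
  shows "autrel (R \<union> Id_on (S - Domain R))" (is "autrel ?Q")
proof -
  have "brel ?Q"
    using R by (intro brel_Un brel_Id_on bset_Diff) (auto simp: pbij_def)
  moreover have "single_valued ?Q"
    using R by (auto simp: single_valued_def pbij_def)
  moreover have "single_valued (?Q\<inverse>)"
    using R eq by (auto simp: single_valued_def pbij_def)
  moreover have "Domain ?Q = S" using pbij_subset[OF R] by auto
  moreover have "Range ?Q = Range R \<union> (S - Range R)" by (simp only: eq) auto
  then have "Range ?Q = S" using pbij_subset[OF R] by auto
  ultimately show ?thesis by (simp add: autrel_def)
qed

section \<open>Cutting a partial bijection along its orbits\<close>

definition iter_image :: "('a set \<times> 'a set) set \<Rightarrow> nat \<Rightarrow> 'a set set" where
  "iter_image R k = ((\<lambda>A. R `` A) ^^ k) S"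

lemma iter_image_simps [simp]:
  "iter_image R 0 = S" "iter_image R (Suc k) = R `` iter_image R k"
  by (simp_all add: iter_image_def)

lemma bset_iter_image: "pbij R \<Longrightarrow> bset (iter_image R k)"
  by (induction k) (auto intro: bset_pbij_image simp del: iter_image_simps(2) simp: iter_image_simps(2)[abs_def])

lemma iter_image_exit:
  assumes "x \<in> S" "x \<notin> iter_image R k"
  obtains j where "x \<in> iter_image R j - iter_image R (Suc j)"
  using assms(2)
proof (induction k)
  case (Suc k)
  then show ?case by (cases "x \<in> iter_image R k") auto
qed (use assms(1) in simp)

text \<open>The bound by \<open>R\<close>, its converse and the identity is what later keeps the
  automorphisms inside the equivalence relation.\<close>

lemma pbij_cover:
  assumes R: "pbij R"
  obtains \<Q> where "countable \<Q>" "\<And>Q. Q \<in> \<Q> \<Longrightarrow> autrel Q" "\<And>Q. Q \<in> \<Q> \<Longrightarrow> Q \<subseteq> R \<union> R\<inverse> \<union> Id_on S"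
    "R \<subseteq> \<Union>\<Q>"
proof -
  \<comment> \<open>\<open>?U k\<close> holds the points with a chain of at least \<open>k\<close>
    predecessors under \<open>R\<close>, and \<open>?V k\<close> those with at least
    \<open>k\<close> successors. So \<open>L k\<close> is \<open>R\<close> on the points with
    exactly \<open>k\<close> predecessors, \<open>M k\<close> is \<open>R\<close> on those with
    exactly \<open>k\<close> successors, and \<open>D\<close> collects the points with arbitrarily
    long chains both ways, finite cycles included.\<close>
  let ?U = "iter_image R" and ?V = "iter_image (R\<inverse>)"
  define cut where "cut = (\<lambda>A. R \<inter> A \<times> UNIV)"
  define swap where "swap = (\<lambda>P :: ('a set \<times> 'a set) set. P \<union> P\<inverse> \<union> Id_on (S - Domain P - Range P))"
  define D where "D = (\<Inter>k. ?U k) \<inter> (\<Inter>k. ?V k)"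
  define L where "L = (\<lambda>k. cut (?U k - ?U (Suc k)))"
  define M where "M = (\<lambda>k. cut (?V k - ?V (Suc k)))"
  define \<Q> where "\<Q> = insert (cut D \<union> Id_on (S - Domain (cut D))) (range (\<lambda>k. swap (L k)) \<union> range (\<lambda>k. swap (M k)))"
  have U: "bset (?U k)" and V: "bset (?V k)" for k
    using R by (auto intro!: bset_iter_image pbij_converse)
  have sv: "b = c" if "(a, b) \<in> R" "(a, c) \<in> R" for a b c
    using R that by (auto simp: pbij_def single_valued_def)
  have sv': "b = c" if "(b, a) \<in> R" "(c, a) \<in> R" for a b c
    using R that by (auto simp: pbij_def single_valued_def)
  have RS: "R \<subseteq> S \<times> S" by (rule pbij_subset[OF R])
  have Dfwd: "d \<in> D" if "c \<in> D" "(c, d) \<in> R" for c d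
  proof -
    have "d \<in> ?U k" for k
    proof (cases k)
      case 0
      then show ?thesis using that RS by auto
    next
      case (Suc j)
      have "c \<in> ?U j" using that(1) by (simp add: D_def)
      then show ?thesis using that(2) Suc by auto
    qed
    \<comment> \<open>The index is shifted by one: \<open>c\<close> has a successor in
      \<open>?V k\<close>, and single-valuedness identifies it with \<open>d\<close>.\<close>
    moreover have "d \<in> ?V k" for k
    proof -
      have "c \<in> ?V (Suc k)" using that(1) unfolding D_def by blast
      then show ?thesis using that(2) sv by auto
    qed
    ultimately show ?thesis by (simp add: D_def)
  qed
  have Dbwd: "c \<in> D" if "d \<in> D" "(c, d) \<in> R" for c d
  proof -
    have "c \<in> ?V k" for k
    proof (cases k)
      case 0
      then show ?thesis using that RS by auto
    next
      case (Suc j)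
      have "d \<in> ?V j" using that(1) by (simp add: D_def)
      then show ?thesis using that(2) Suc by auto
    qed
    moreover have "c \<in> ?U k" for k
    proof -
      have "d \<in> ?U (Suc k)" using that(1) unfolding D_def by blast
      then show ?thesis using that(2) sv' by auto
    qed
    ultimately show ?thesis by (simp add: D_def)
  qed
  have Dends: "c \<in> Domain R \<and> c \<in> Range R" if "c \<in> D" for c
  proof -
    have "c \<in> ?U (Suc 0)" "c \<in> ?V (Suc 0)" using that unfolding D_def by blast+
    then show ?thesis by auto
  qed
  have cutD: "Domain (cut D) = Range (cut D)"
  proof (intro equalityI subsetI)
    fix c assume "c \<in> Domain (cut D)"
    then have "c \<in> D" by (auto simp: cut_def)
    then obtain b where "(b, c) \<in> R" using Dends by blast
    with Dbwd[OF \<open>c \<in> D\<close>] show "c \<in> Range (cut D)" by (auto simp: cut_def)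
  next
    fix c assume "c \<in> Range (cut D)"
    then have "c \<in> D" using Dfwd by (auto simp: cut_def)
    with Dends show "c \<in> Domain (cut D)" by (auto simp: cut_def)
  qed
  have "pbij (cut D)"
    unfolding cut_def D_def using U V by (intro pbij_restrict R bset_Int bset_INT)
  then have autD: "autrel (cut D \<union> Id_on (S - Domain (cut D)))"
    using cutD by (rule autrel_fill)
  have autL: "autrel (swap (L k))" for k
    unfolding swap_def
  proof (rule autrel_swap)
    show "pbij (L k)" unfolding L_def cut_def by (intro pbij_restrict R bset_Diff U)
    \<comment> \<open>The image of a point of \<open>?U k\<close> lies in \<open>?U (Suc k)\<close>,
      which the domain excludes.\<close>
    show "Domain (L k) \<inter> Range (L k) = {}" by (auto simp: L_def cut_def)
  qed
  have autM: "autrel (swap (M k))" for k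
    unfolding swap_def
  proof (rule autrel_swap)
    show "pbij (M k)" unfolding M_def cut_def by (intro pbij_restrict R bset_Diff V)
    \<comment> \<open>If the image were in \<open>?V k\<close>, the point itself would be in
      \<open>?V (Suc k)\<close>, which the domain excludes.\<close>
    show "Domain (M k) \<inter> Range (M k) = {}" by (auto simp: M_def cut_def)
  qed
  show thesis
  proof
    show "countable \<Q>" by (simp add: \<Q>_def)
    show "autrel Q" if "Q \<in> \<Q>" for Q
      using that autD autL autM by (auto simp: \<Q>_def)
    show "Q \<subseteq> R \<union> R\<inverse> \<union> Id_on S" if "Q \<in> \<Q>" for Q
      using that by (auto simp: \<Q>_def swap_def cut_def L_def M_def)
    show "R \<subseteq> \<Union>\<Q>"
    proof (rule subrelI)
      fix c d assume cd: "(c, d) \<in> R"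
      then have cS: "c \<in> S" using RS by blast
      consider "c \<in> D" | k where "c \<notin> ?U k" | k where "c \<notin> ?V k"
        unfolding D_def by blast
      then show "(c, d) \<in> \<Union>\<Q>"
      proof cases
        case 1
        then show ?thesis using cd by (auto simp: \<Q>_def cut_def)
      next
        case 2
        then obtain j where "c \<in> ?U j - ?U (Suc j)" using iter_image_exit[OF cS] by blast
        then have "(c, d) \<in> swap (L j)" using cd by (auto simp: swap_def L_def cut_def)
        then show ?thesis by (auto simp: \<Q>_def)
      next
        case 3
        then obtain j where "c \<in> ?V j - ?V (Suc j)" using iter_image_exit[OF cS] by blast
        then have "(c, d) \<in> swap (M j)" using cd by (auto simp: swap_def M_def cut_def)
        then show ?thesis by (auto simp: \<Q>_def)
      qed
    qed
  qed
qed

text \<open>The first graph makes the intersection functional, the second makes it injective. Its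
  range is the domain of the same kind of intersection with \<open>f\<close> and \<open>g\<close>
  exchanged, so one domain lemma serves both.\<close>

lemma pbij_graph_Int:
  assumes "borel_endomorphism X E f" "borel_endomorphism X E g"
  shows "pbij (graph_on S f \<inter> (graph_on S g)\<inverse>)"
proof -
  have br: "brel (graph_on S f)" "brel (graph_on S g)"
    using assms by (simp_all add: borel_endomorphism_def borel_function_def)
  have sv: "single_valued (graph_on S h)" and dom: "Domain (graph_on S h) = S" for h :: "'a set \<Rightarrow> 'a set"
    by (auto simp: graph_on_def single_valued_def)
  have "bset (Domain (graph_on S f \<inter> (graph_on S g)\<inverse>))"
    by (intro bset_Domain_Int brel_converse br sv) (simp add: dom)
  moreover have "bset (Domain (graph_on S g \<inter> (graph_on S f)\<inverse>))"
    by (intro bset_Domain_Int brel_converse br sv) (simp add: dom)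
  moreover have "Domain (graph_on S g \<inter> (graph_on S f)\<inverse>) = Range (graph_on S f \<inter> (graph_on S g)\<inverse>)"
    by auto
  moreover have "single_valued (graph_on S f \<inter> (graph_on S g)\<inverse>)"
    "single_valued ((graph_on S f \<inter> (graph_on S g)\<inverse>)\<inverse>)"
    by (auto intro: single_valued_subset[OF _ sv[of f]] single_valued_subset[OF _ sv[of g]])
  ultimately show ?thesis
    using brel_Int[OF br(1) brel_converse[OF br(2)]] by (simp add: pbij_def)
qed

text \<open>By symmetry \<open>F = F \<inter> F\<inverse>\<close>, and expanding both factors over
  the enumeration gives the pieces \<open>R (n, m)\<close>. Symmetry and reflexivity of
  \<open>F\<close> then absorb the converses and the identity added by
  \<open>pbij_cover\<close>.\<close>

lemma enumerable_cover:
  assumes F: "equiv S F" and "borel_enumerable X E F"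
  obtains \<Q> where "countable \<Q>" "\<And>Q. Q \<in> \<Q> \<Longrightarrow> autrel Q" "\<Union>\<Q> = F"
proof -
  obtain f where f: "\<And>n :: nat. borel_endomorphism X E (f n)" "F = (\<Union>n. graph_on S (f n))"
    using assms(2) unfolding borel_enumerable_def by blast
  define R where "R = (\<lambda>(n, m). graph_on S (f n) \<inter> (graph_on S (f m))\<inverse>)"
  have symF: "F\<inverse> = F" using F by (auto simp: equiv_def sym_conv_converse_eq)
  have RF: "R p \<subseteq> F" for p using f(2) by (auto simp: R_def split: prod.split)
  have "(\<Union>p. R p) = F \<inter> F\<inverse>" unfolding f(2) R_def by auto
  then have UR: "(\<Union>p. R p) = F" by (simp add: symF)
  have IdF: "Id_on S \<subseteq> F" using F by (auto simp: equiv_def refl_on_def)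
  have "\<forall>p. \<exists>\<Q>. countable \<Q> \<and> (\<forall>Q\<in>\<Q>. autrel Q \<and> Q \<subseteq> R p \<union> (R p)\<inverse> \<union> Id_on S) \<and> R p \<subseteq> \<Union>\<Q>"
  proof
    fix p
    have "pbij (R p)" unfolding R_def by (cases p) (simp add: pbij_graph_Int f(1))
    from pbij_cover[OF this] show "\<exists>\<Q>. countable \<Q> \<and> (\<forall>Q\<in>\<Q>. autrel Q \<and> Q \<subseteq> R p \<union> (R p)\<inverse> \<union> Id_on S) \<and> R p \<subseteq> \<Union>\<Q>"
      by metis
  qed
  then obtain \<Q> where \<Q>: "\<And>p. countable (\<Q> p)" "\<And>p Q. Q \<in> \<Q> p \<Longrightarrow> autrel Q"
    "\<And>p Q. Q \<in> \<Q> p \<Longrightarrow> Q \<subseteq> R p \<union> (R p)\<inverse> \<union> Id_on S" "\<And>p. R p \<subseteq> \<Union>(\<Q> p)"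
    by metis
  show thesis
  proof
    show "countable (\<Union>p. \<Q> p)" using \<Q>(1) by blast
    show "autrel Q" if "Q \<in> (\<Union>p. \<Q> p)" for Q using that \<Q>(2) by blast
    have sub: "Q \<subseteq> F" if "Q \<in> \<Q> p" for p Q
    proof -
      have "(R p)\<inverse> \<subseteq> F\<inverse>" using RF by blast
      then show ?thesis using \<Q>(3)[OF that] RF[of p] IdF symF by blast
    qed
    show "\<Union>(\<Union>p. \<Q> p) = F"
    proof
      show "\<Union>(\<Union>p. \<Q> p) \<subseteq> F" using sub by blast
      have "(\<Union>p. R p) \<subseteq> (\<Union>p. \<Union>(\<Q> p))" by (intro UN_mono \<Q>(4)) simp
      then show "F \<subseteq> \<Union>(\<Union>p. \<Q> p)" unfolding UR by blast
    qed
  qed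
qed

end

section \<open>Countable groups of Borel automorphisms\<close>

text \<open>Every generated element is the value of a finite word in the generators and their
  inverses, and there are countably many such words.\<close>

lemma (in group) countable_generate:
  assumes "H \<subseteq> carrier G" "countable H"
  shows "countable (generate G H)"
proof -
  define K where "K = H \<union> m_inv G ` H"
  define w where "w = (\<lambda>xs. foldr (\<otimes>) xs \<one>)"
  have K: "K \<subseteq> carrier G" using assms(1) by (auto simp: K_def)
  have w_closed: "w xs \<in> carrier G" if "xs \<in> lists K" for xs
    using that K by (induction xs) (auto simp: w_def)
  have w_append: "w (xs @ ys) = w xs \<otimes> w ys" if "xs \<in> lists K" "ys \<in> lists K" for xs ys
    using that(1)
  proof (induction xs)
    case Nil
    then show ?case using w_closed[OF that(2)] by (simp add: w_def)
  next
    case (Cons x xs)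
    then have "x \<in> carrier G" "w xs \<in> carrier G" using K w_closed by auto
    with Cons show ?case using w_closed[OF that(2)] m_assoc by (simp add: w_def)
  qed
  have "x \<in> w ` lists K" if "x \<in> generate G H" for x
    using that
  proof induction
    case one
    have "w [] = \<one>" by (simp add: w_def)
    then show ?case by (metis imageI lists.Nil)
  next
    case (incl h)
    then have "w [h] = h" "[h] \<in> lists K" using K by (auto simp: w_def K_def)
    then show ?case by (metis imageI)
  next
    case (inv h)
    then have "w [inv h] = inv h" "[inv h] \<in> lists K" using K by (auto simp: w_def K_def)
    then show ?case by (metis imageI)
  next
    case (eng h1 h2)
    then obtain xs ys where "xs \<in> lists K" "h1 = w xs" "ys \<in> lists K" "h2 = w ys" by blast
    then have "h1 \<otimes> h2 = w (xs @ ys)" "xs @ ys \<in> lists K" using w_append by auto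
    then show ?case by blast
  qed
  moreover have "countable (w ` lists K)"
    using assms(2) by (auto simp: K_def)
  ultimately show ?thesis
    by (meson countable_subset subsetI)
qed

text \<open>The group structure of \<open>K\<close> is transported along an injection into the
  natural numbers; decoding a number back to its permutation is the action.\<close>

lemma countable_permutation_group_action:
  assumes K: "subgroup K (BijGroup S)" and "countable K"
  obtains \<Gamma> :: "nat monoid" and \<phi>
  where "group \<Gamma>" "group_action \<Gamma> S \<phi>" "\<phi> ` carrier \<Gamma> = K"
proof -
  interpret B: group "BijGroup S" by (rule group_BijGroup)
  let ?K = "BijGroup S\<lparr>carrier := K\<rparr>"
  interpret K: group ?K by (rule B.subgroup_imp_group[OF K])
  define e where "e = to_nat_on K"
  have inj: "inj_on e (carrier ?K)" using assms(2) by (simp add: e_def inj_on_to_nat_on)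
  define \<Gamma> where "\<Gamma> = image_group e ?K"
  define \<phi> where "\<phi> = inv_into (carrier ?K) e"
  have grp: "group \<Gamma>" unfolding \<Gamma>_def by (rule K.inj_imp_image_group_is_group[OF inj])
  have iso: "\<phi> \<in> iso \<Gamma> ?K"
    unfolding \<phi>_def \<Gamma>_def by (rule K.iso_set_sym[OF inj_imp_image_group_iso[OF inj]])
  then have img: "\<phi> ` carrier \<Gamma> = K" by (auto simp: iso_def bij_betw_def)
  have "\<phi> \<in> hom \<Gamma> (BijGroup S)"
    using iso subgroup.subset[OF K] by (auto simp: iso_def hom_def)
  then have "group_action \<Gamma> S \<phi>"
    using grp B.group_axioms
    by (simp add: group_action_def group_hom_def group_hom_axioms_def)
  then show thesis using that grp img by blast
qed

section \<open>From automorphisms to a Borel group action\<close>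

context quotient_borel
begin

lemma autrel_graphE:
  assumes "autrel R"
  obtains t where "t \<in> Bij S" "graph_on S t = R"
proof -
  have R: "R \<subseteq> S \<times> S" "single_valued R" "single_valued (R\<inverse>)" "Domain R = S" "Range R = S"
    using assms by (auto simp: autrel_def brel_iff)
  \<comment> \<open>Elements of \<open>Bij S\<close> are extensional, hence the restriction to
    \<open>S\<close>; it also makes a permutation recoverable from its graph.\<close>
  define t where "t = (\<lambda>C\<in>S. THE D. (C, D) \<in> R)"
  have t: "t C = D" if "(C, D) \<in> R" for C D
  proof -
    have "(THE D. (C, D) \<in> R) = D"
      using that R(2) by (intro the_equality) (auto simp: single_valued_def)
    then show ?thesis using that R(1) by (auto simp: t_def)
  qed
  have tR: "(C, t C) \<in> R" if "C \<in> S" for C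
    using that R(4) t by (metis DomainE)
  have g: "graph_on S t = R"
    using t tR R(1) by (auto simp: graph_on_def)
  have "inj_on t S"
    using tR R(3) by (intro inj_onI) (metis converse.intros single_valuedD)
  moreover have "t ` S = S"
    using R(5) g by (auto simp: graph_on_def)
  ultimately have "t \<in> Bij S"
    by (simp add: Bij_def bij_betw_def t_def)
  then show thesis using g that by blast
qed

lemma graph_on_compose:
  "g \<in> Bij S \<Longrightarrow> f \<in> Bij S \<Longrightarrow> graph_on S (compose S g f) = graph_on S f O graph_on S g"
  using Bij_imp_funcset[of f S] by (force simp: graph_on_def compose_def)

lemma graph_on_inv:
  assumes "f \<in> Bij S"
  shows "graph_on S (\<lambda>x\<in>S. inv_into S f x) = (graph_on S f)\<inverse>"
proof -
  have f: "bij_betw f S S" using assms by (simp add: Bij_def)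
  then have "inv_into S f y \<in> S" "f (inv_into S f y) = y" if "y \<in> S" for y
    using that by (auto simp: bij_betw_def f_inv_into_f inv_into_into)
  moreover have "inv_into S f (f x) = x" "f x \<in> S" if "x \<in> S" for x
    using that f by (auto simp: bij_betw_def)
  ultimately show ?thesis by (auto simp: graph_on_def)
qed

lemma borel_automorphism_Bij:
  assumes "t \<in> Bij S"
  shows "borel_automorphism X E t \<longleftrightarrow> brel (graph_on S t)"
  using assms Bij_imp_funcset[OF assms]
  by (auto simp: borel_automorphism_def borel_endomorphism_def borel_function_def Bij_def)

text \<open>This is the upper bound for the generated group: Borelness and containment in
  \<open>F\<close> both pass to products and inverses, the former through
  \<open>brel_relcomp\<close> and \<open>brel_converse\<close>, the latter because \<open>F\<close>
  is an equivalence relation.\<close>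

lemma subgroup_borel_automorphisms:
  assumes F: "equiv S F"
  shows "subgroup {t \<in> Bij S. brel (graph_on S t) \<and> graph_on S t \<subseteq> F} (BijGroup S)" (is "subgroup ?K _")
proof -
  have symF: "F\<inverse> = F" and transF: "F O F \<subseteq> F" and IdF: "Id_on S \<subseteq> F"
    using F by (auto simp: equiv_def sym_conv_converse_eq refl_on_def elim: transE)
  have gs: "single_valued (graph_on S t)" "Domain (graph_on S t) = S" for t :: "'a set \<Rightarrow> 'a set"
    by (auto simp: graph_on_def single_valued_def)
  show ?thesis
  proof
    show "?K \<subseteq> carrier (BijGroup S)" by (auto simp: BijGroup_def)
    have "graph_on S (\<lambda>x\<in>S. x) = Id_on S" by (auto simp: graph_on_def)
    then show "\<one>\<^bsub>BijGroup S\<^esub> \<in> ?K"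
      using brel_Id IdF by (simp add: BijGroup_def id_Bij)
  next
    fix g f assume gf: "g \<in> ?K" "f \<in> ?K"
    have "brel (graph_on S f O graph_on S g)"
      using gf by (intro brel_relcomp gs) auto
    moreover have "graph_on S f O graph_on S g \<subseteq> F" using gf transF by blast
    ultimately show "g \<otimes>\<^bsub>BijGroup S\<^esub> f \<in> ?K"
      using gf by (simp add: BijGroup_def compose_Bij graph_on_compose)
  next
    fix f assume f: "f \<in> ?K"
    then have "(graph_on S f)\<inverse> \<subseteq> F" using symF by blast
    with f show "inv\<^bsub>BijGroup S\<^esub> f \<in> ?K"
      by (simp add: inv_BijGroup restrict_inv_into_Bij graph_on_inv brel_converse del: restrict_apply)
  qed
qed

lemma enumerable_orbit_equiv:
  assumes F: "equiv S F" and "borel_enumerable X E F"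
  obtains \<Gamma> :: "nat monoid" and \<phi>
  where "group \<Gamma>" "borel_action \<Gamma> X E \<phi>" "orbit_equiv \<Gamma> S \<phi> = F"
proof -
  obtain \<Q> where \<Q>: "countable \<Q>" "\<And>Q. Q \<in> \<Q> \<Longrightarrow> autrel Q" "\<Union>\<Q> = F"
    using enumerable_cover[OF assms] by blast
  interpret B: group "BijGroup S" by (rule group_BijGroup)
  define H where "H = {t \<in> Bij S. graph_on S t \<in> \<Q>}"
  define K where "K = generate (BijGroup S) H"
  have H: "H \<subseteq> carrier (BijGroup S)" by (auto simp: H_def BijGroup_def)
  \<comment> \<open>Permutations in \<open>Bij S\<close> are determined by their graphs, so
    countability of \<open>\<Q>\<close> passes to the set \<open>H\<close> of generators.\<close>
  have "inj_on (graph_on S) (Bij S)"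
  proof (rule inj_onI)
    fix s t assume st: "s \<in> Bij S" "t \<in> Bij S" "graph_on S s = graph_on S t"
    have "s x = t x" if "x \<in> S" for x
    proof -
      have "(x, s x) \<in> graph_on S s" using that by (auto simp: graph_on_def)
      then have "(x, s x) \<in> graph_on S t" by (simp only: st(3))
      then show ?thesis by (simp add: graph_on_def)
    qed
    with st(1,2) show "s = t"
      by (auto simp: Bij_def intro: extensionalityI)
  qed
  then have "inj_on (graph_on S) H" by (rule inj_on_subset) (auto simp: H_def)
  moreover have "countable (graph_on S ` H)"
    by (rule countable_subset[OF _ \<Q>(1)]) (auto simp: H_def)
  ultimately have "countable H" by (rule countable_image_inj_on[rotated])
  then have cK: "countable K"
    unfolding K_def by (rule B.countable_generate[OF H])
  have sK: "subgroup K (BijGroup S)"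
    unfolding K_def by (rule B.generate_is_subgroup[OF H])
  have "H \<subseteq> {t \<in> Bij S. brel (graph_on S t) \<and> graph_on S t \<subseteq> F}"
    using \<Q>(2,3) by (auto simp: H_def autrel_def)
  then have K: "K \<subseteq> {t \<in> Bij S. brel (graph_on S t) \<and> graph_on S t \<subseteq> F}"
    unfolding K_def by (rule B.generate_subgroup_incl[OF _ subgroup_borel_automorphisms[OF F]])
  obtain \<Gamma> :: "nat monoid" and \<phi> where \<Gamma>: "group \<Gamma>" "group_action \<Gamma> S \<phi>" "\<phi> ` carrier \<Gamma> = K"
    by (rule countable_permutation_group_action[OF sK cK])
  have "borel_automorphism X E (\<phi> g)" if "g \<in> carrier \<Gamma>" for g
  proof -
    have "\<phi> g \<in> K" using that \<Gamma>(3) by blast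
    then show ?thesis using K borel_automorphism_Bij by blast
  qed
  then have "borel_action \<Gamma> X E \<phi>"
    using \<Gamma>(2) by (simp add: borel_action_def)
  moreover have "orbit_equiv \<Gamma> S \<phi> = F"
  proof (intro equalityI subrelI)
    fix C D assume "(C, D) \<in> orbit_equiv \<Gamma> S \<phi>"
    then obtain g where g: "C \<in> S" "g \<in> carrier \<Gamma>" "D = \<phi> g C" by (auto simp: orbit_equiv_def)
    then have "graph_on S (\<phi> g) \<subseteq> F" using \<Gamma>(3) K by blast
    with g show "(C, D) \<in> F" by (auto simp: graph_on_def)
  next
    \<comment> \<open>The lower bound: the pair lies in some member of \<open>\<Q>\<close>, which is
      the graph of a generator, so one group element already moves \<open>C\<close> to
      \<open>D\<close>.\<close>
    fix C D assume "(C, D) \<in> F"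
    then obtain Q where Q: "(C, D) \<in> Q" "Q \<in> \<Q>" using \<Q>(3) by blast
    obtain t where t: "t \<in> Bij S" "graph_on S t = Q" using autrel_graphE[OF \<Q>(2)[OF Q(2)]] by blast
    then have "t \<in> K" using Q(2) by (auto simp: K_def H_def intro: generate.incl)
    then obtain g where "g \<in> carrier \<Gamma>" "t = \<phi> g" using \<Gamma>(3) by blast
    moreover have "C \<in> S" "D = t C" using Q(1) t(2) by (auto simp: graph_on_def)
    ultimately show "(C, D) \<in> orbit_equiv \<Gamma> S \<phi>" by (auto simp: orbit_equiv_def)
  qed
  ultimately show thesis using that \<Gamma>(1) by blast
qed

end

theorem theorem2p9:
  fixes X :: "'a measure" and E :: "('a \<times> 'a) set" and F :: "('a set \<times> 'a set) set"
  assumes "standard_borel_space X"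
    and "countable_borel_equiv X E"
    and "equiv (space X // E) F"
    and "borel_enumerable X E F"
  shows "\<exists>(\<Gamma> :: nat monoid) \<phi>.
           group \<Gamma> \<and> countable (carrier \<Gamma>) \<and> borel_action \<Gamma> X E \<phi> \<and>
           orbit_equiv \<Gamma> (space X // E) \<phi> = F"
proof -
  obtain T where "suslin_space X T"
    using assms(1) by (rule standard_borel_suslin)
  then interpret quotient_borel X E T
    using assms(2) by unfold_locales (auto simp: countable_borel_equiv_def)
  show ?thesis
    using enumerable_orbit_equiv[OF assms(3,4)] by (metis countableI_type)
qed

end
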